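(* Let $t$ be a positive integer. Suppose that $H$ is a graph for which there exist a function $f:(0,1]\to(0,1]$ and a constant $a>0$ such that, for every $d\in(0,1]$, every $(f(d),d)$-dense graph $G$ contains at least $a|V(G)|^{|V(H)|}d^{|E(H)|}$ copies of $H$. Then the $K_{2,t}$-replacement of $H$ has Sidorenko's property.
   Context: Graphs are finite and simple. A graph $G$ is $(\rho,d)$-dense if for every $U\subseteq V(G)$ with $|U|\ge\rho|V(G)|$, the number of edges of $G$ inside $U$ is at least $d\binom{|U|}{2}$. Copies of $H$ are counted as labeled copies. $\mathrm{Hom}(H,G)$ is the set of homomorphisms $H\to G$; $H$ has Sidorenko's property if for every graph $G$, $|\mathrm{Hom}(H,G)|\ge |V(G)|^{|V(H)|}\left(\frac{2|E(G)|}{|V(G)|^2}\right)^{|E(H)|}$. The $K_{2,t}$-replacement of $H$ is the graph obtained from $H$ by replacing each edge $\{x,y\}$ by a copy of the complete bipartite graph $K_{2,t}$ whose two-vertex side is identified with $\{x,y\}$ (the $t$ other vertices being new and distinct for each edge, and the original edge $\{x,y\}$ removed). For $t=1$ this is the subdivision of $H$. *)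

theory Defs
  imports Complex_Main "HOL-Library.FuncSet"
begin

datatype 'a graph = Graph (verts: "'a set") (edges: "'a set set")

definition simple_graph :: "'a graph \<Rightarrow> bool" where
  "simple_graph G \<longleftrightarrow> finite (verts G) \<and> (\<forall>e\<in>edges G. e \<subseteq> verts G \<and> card e = 2)"

text \<open>
  Homomorphisms are extensional functions, so that each one is counted once. Edges of a simple
  graph have two elements, so a homomorphism never collapses an edge.
\<close>
definition homs :: "'a graph \<Rightarrow> 'b graph \<Rightarrow> ('a \<Rightarrow> 'b) set" where
  "homs H G = {\<phi> \<in> verts H \<rightarrow>\<^sub>E verts G. \<forall>e\<in>edges H. \<phi> ` e \<in> edges G}"

definition labelled_copies :: "'a graph \<Rightarrow> 'b graph \<Rightarrow> ('a \<Rightarrow> 'b) set" where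
  "labelled_copies H G = {\<phi> \<in> homs H G. inj_on \<phi> (verts H)}"

text \<open>
  A graph with a single vertex satisfies this for all \<open>\<rho>\<close> and \<open>d\<close>, but contains no injective copy of
  a larger \<open>H\<close>. Lower bounds on copies in all dense graphs are therefore only satisfiable when
  restricted to sufficiently large graphs.
\<close>
definition dense_graph :: "real \<Rightarrow> real \<Rightarrow> 'a graph \<Rightarrow> bool" where
  "dense_graph \<rho> d G \<longleftrightarrow>
     (\<forall>U \<subseteq> verts G. real (card U) \<ge> \<rho> * real (card (verts G)) \<longrightarrow>
        real (card {e \<in> edges G. e \<subseteq> U}) \<ge> d * real (card U choose 2))"

text \<open>
  A definition cannot quantify over vertex types, so the host graphs have vertices in \<open>nat\<close>; every
  finite graph is isomorphic to such a graph. The lemma \<open>sidorenkoD\<close> below gives the inequality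
  for host graphs over an arbitrary type. If the host has no vertices, the quotient is
  \<open>0 / 0 = 0\<close> and the inequality holds trivially.
\<close>
definition sidorenko :: "'a graph \<Rightarrow> bool" where
  "sidorenko H \<longleftrightarrow>
     (\<forall>G :: nat graph. simple_graph G \<longrightarrow>
        real (card (homs H G)) \<ge>
          real (card (verts G)) ^ card (verts H) *
          (2 * real (card (edges G)) / real (card (verts G)) ^ 2) ^ card (edges H))"

text \<open>
  \<open>Inl x\<close> is the original vertex \<open>x\<close>; \<open>Inr (e, i)\<close> is the \<open>i\<close>-th of the \<open>t\<close> new vertices
  belonging to the edge \<open>e\<close>.
\<close>
definition K2_replacement :: "nat \<Rightarrow> 'a graph \<Rightarrow> ('a + 'a set \<times> nat) graph" where
  "K2_replacement t H =
     Graph (Inl ` verts H \<union> Inr ` (edges H \<times> {..<t}))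
           {{Inl x, Inr (e, i)} | x e i. e \<in> edges H \<and> x \<in> e \<and> i < t}"

lemma simple_graph_K2_replacement:
  assumes "simple_graph H"
  shows "simple_graph (K2_replacement t H)"
proof -
  have "finite (edges H)"
    using assms by (auto simp: simple_graph_def intro: finite_subset[of _ "Pow (verts H)"])
  then show ?thesis
    using assms by (fastforce simp: simple_graph_def K2_replacement_def)
qed

lemma sidorenkoD:
  fixes G :: "'b graph"
  assumes "sidorenko H" "simple_graph H" "simple_graph G"
  shows "real (card (homs H G)) \<ge>
           real (card (verts G)) ^ card (verts H) *
           (2 * real (card (edges G)) / real (card (verts G)) ^ 2) ^ card (edges H)"
proof -
  have fin: "finite (verts G)" and finH: "finite (verts H)"
    using assms by (auto simp: simple_graph_def)
  obtain b where b: "bij_betw b (verts G) {0..<card (verts G)}"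
    using ex_bij_betw_finite_nat[OF fin] by blast
  have inj: "inj_on b (verts G)" using b by (simp add: bij_betw_def)
  define G' where "G' = Graph (b ` verts G) ((`) b ` edges G)"
  have sub: "e \<subseteq> verts G" if "e \<in> edges G" for e
    using assms(3) that by (auto simp: simple_graph_def)
  have "inj_on ((`) b) (edges G)"
    by (rule inj_onI) (metis sub inj inj_on_image_eq_iff)
  then have E: "card (edges G') = card (edges G)" by (simp add: G'_def card_image)
  have V: "card (verts G') = card (verts G)" using inj by (simp add: G'_def card_image)
  have "simple_graph G'"
    using assms(3) inj
    by (auto simp: simple_graph_def G'_def card_image inj_on_subset)
  then have S: "real (card (homs H G')) \<ge>
           real (card (verts G)) ^ card (verts H) *
           (2 * real (card (edges G)) / real (card (verts G)) ^ 2) ^ card (edges H)"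
    using assms(1) unfolding sidorenko_def E[symmetric] V[symmetric] by blast
  define g where "g = inv_into (verts G) b"
  have gin: "g y \<in> verts G" if "y \<in> verts G'" for y
    using that by (auto simp: g_def G'_def inv_into_into)
  have gb: "g ` b ` e = e" if "e \<in> edges G" for e
    unfolding g_def using inv_into_image_cancel[OF inj sub[OF that]] .
  have bg: "b (g y) = y" if "y \<in> verts G'" for y
    using that by (auto simp: g_def G'_def f_inv_into_f)
  have "finite (verts H \<rightarrow>\<^sub>E verts G)" using fin finH by (simp add: finite_PiE)
  then have finh: "finite (homs H G)" by (rule rev_finite_subset) (auto simp: homs_def)
  let ?F = "\<lambda>\<phi>. restrict (g \<circ> \<phi>) (verts H)"
  have "?F ` homs H G' \<subseteq> homs H G"
  proof
    fix \<psi> assume "\<psi> \<in> ?F ` homs H G'"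
    then obtain \<phi> where \<phi>: "\<phi> \<in> homs H G'" and \<psi>: "\<psi> = ?F \<phi>" by blast
    have "\<psi> ` e \<in> edges G" if e: "e \<in> edges H" for e
    proof -
      have eH: "e \<subseteq> verts H" using e assms(2) by (auto simp: simple_graph_def)
      then have "\<psi> ` e = g ` \<phi> ` e" unfolding \<psi> by (force simp: image_iff)
      moreover have "\<phi> ` e \<in> (`) b ` edges G" using \<phi> e by (auto simp: homs_def G'_def)
      ultimately show ?thesis using gb by auto
    qed
    moreover have "\<psi> \<in> verts H \<rightarrow>\<^sub>E verts G"
      using \<phi> gin unfolding \<psi> homs_def by (auto simp: PiE_iff)
    ultimately show "\<psi> \<in> homs H G" by (simp add: homs_def)
  qed
  moreover have "inj_on ?F (homs H G')"
  proof (rule inj_onI)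
    fix \<phi> \<psi> assume 1: "\<phi> \<in> homs H G'" "\<psi> \<in> homs H G'" and eq: "?F \<phi> = ?F \<psi>"
    then have P: "\<phi> \<in> verts H \<rightarrow>\<^sub>E verts G'" "\<psi> \<in> verts H \<rightarrow>\<^sub>E verts G'" by (auto simp: homs_def)
    show "\<phi> = \<psi>"
    proof (rule PiE_ext[OF P])
      fix x assume x: "x \<in> verts H"
      have "g (\<phi> x) = g (\<psi> x)" using fun_cong[OF eq, of x] x by simp
      then show "\<phi> x = \<psi> x" using bg P x by (metis PiE_mem)
    qed
  qed
  ultimately have "card (homs H G') \<le> card (homs H G)"
    using finh by (metis card_inj_on_le)
  then show ?thesis using S by linarith
qed

end

(*
  Write p for the edge density of a bipartite relation R on X and Y. Homomorphisms of the
  replacement are counted by summing, over maps from the vertices of H to X, the product over the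
  edges of H of the number of common neighbours in Y of the image; replacing Y by Y^t reduces the
  problem to t = 1, where the sum must be at least |X|^v |Y|^e p^(2e).

  Suppose that every vertex of A has degree at least delta |Y|. By Cauchy-Schwarz the average
  codegree in every large subset of A is about delta^2 |Y| or more. If each pair of vertices of A
  is made an edge with probability codegree / |Y|, then after a blow-up of A the random graph is
  dense in all large subsets, with density delta^2 / 8. The hypothesis then bounds the expected
  number of copies of H in it, which is at most the desired sum divided by |Y|^e. Taking for A the
  vertices above a suitable degree threshold loses only a constant and a power of the harmonic
  number of |Y|, and the tensor power trick removes both.
*)
theory Submission imports Defs "HOL-Analysis.Harmonic_Numbers" begin

section \<open>Codegrees in a bipartite relation\<close>

definition common_nbrs :: "('b \<Rightarrow> 'c \<Rightarrow> bool) \<Rightarrow> 'c set \<Rightarrow> 'b set \<Rightarrow> 'c set" where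
  "common_nbrs R Y S = {y \<in> Y. \<forall>x\<in>S. R x y}"

text \<open>This counts the homomorphisms of the subdivision of \<open>(V, E)\<close> into the
  relation \<open>R\<close> that send old vertices to \<open>X\<close> and new ones to
  \<open>Y\<close>. Maps \<open>\<phi>\<close> that collapse an edge take part, the factor then
  being a degree. \<open>V\<close> and \<open>E\<close> are separate arguments so that isolated
  vertices can be removed while the edges stay.\<close>

definition codeg_count :: "'a set \<Rightarrow> 'a set set \<Rightarrow> ('b \<Rightarrow> 'c \<Rightarrow> bool) \<Rightarrow> 'b set \<Rightarrow> 'c set \<Rightarrow> real" where
  "codeg_count V E R X Y =
     (\<Sum>\<phi>\<in>V \<rightarrow>\<^sub>E X. \<Prod>e\<in>E. real (card (common_nbrs R Y (\<phi> ` e))))"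

definition pairs :: "'b set \<Rightarrow> 'b set set" where
  "pairs A = {p. p \<subseteq> A \<and> card p = 2}"

lemma finite_pairs: "finite A \<Longrightarrow> finite (pairs A)"
  unfolding pairs_def by (rule finite_subset[of _ "Pow A"]) auto

lemma card_pairs: "finite A \<Longrightarrow> card (pairs A) = card A choose 2"
  unfolding pairs_def by (rule n_subsets)

lemma real_choose_two: "real (n choose 2) = real n * (real n - 1) / 2"
proof -
  have "even (n * (n - 1))" by (cases n) auto
  then have "2 * (n choose 2) = n * (n - 1)" by (simp add: choose_two)
  then have "2 * real (n choose 2) = real (n * (n - 1))" by (metis of_nat_mult of_nat_numeral)
  also have "\<dots> = real n * (real n - 1)" by (cases n) (auto simp: algebra_simps)
  finally show ?thesis by simp
qed

text \<open>Double counting of the incidences between a pair in \<open>U\<close> and a common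
  neighbour of it.\<close>

lemma sum_codeg_pairs:
  assumes "finite U" "finite Y"
  shows "(\<Sum>p\<in>pairs U. card (common_nbrs R Y p)) = (\<Sum>y\<in>Y. card {x\<in>U. R x y} choose 2)"
  unfolding common_nbrs_def
proof (rule sum_multicount_gen)
  show "\<forall>y\<in>Y. card {p \<in> pairs U. \<forall>x\<in>p. R x y} = card {x \<in> U. R x y} choose 2"
  proof
    fix y
    have "{p \<in> pairs U. \<forall>x\<in>p. R x y} = pairs {x \<in> U. R x y}" by (auto simp: pairs_def)
    then show "card {p \<in> pairs U. \<forall>x\<in>p. R x y} = card {x \<in> U. R x y} choose 2"
      using assms by (simp add: card_pairs)
  qed
qed (use assms finite_pairs in auto)

text \<open>Convexity of \<open>k * (k - 1) / 2\<close>: the numbers \<open>k y\<close> of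
  neighbours in \<open>U\<close> have average at least \<open>m = \<delta> * card U\<close>, and
  each term of the double count is bounded below by a linear function of \<open>k y\<close>.\<close>

lemma sum_codeg_pairs_ge:
  assumes fin: "finite U" "finite Y"
    and deg: "\<And>x. x \<in> U \<Longrightarrow> real (card {y\<in>Y. R x y}) \<ge> \<delta> * real (card Y)"
    and big: "\<delta> * real (card U) \<ge> 2"
  shows "(\<Sum>p\<in>pairs U. real (card (common_nbrs R Y p))) \<ge> real (card Y) * (\<delta> * real (card U))\<^sup>2 / 4"
proof -
  define m where "m = \<delta> * real (card U)"
  define k where "k y = real (card {x\<in>U. R x y})" for y
  have m2: "m \<ge> 2" using big by (simp add: m_def)
  have "(\<Sum>y\<in>Y. k y) = (\<Sum>x\<in>U. real (card {y\<in>Y. R x y}))"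
    unfolding k_def using sum_multicount_gen[of Y U "\<lambda>y x. R x y" "\<lambda>x. card {y\<in>Y. R x y}"] fin
    by (simp flip: of_nat_sum)
  also have "\<dots> \<ge> (\<Sum>x\<in>U. \<delta> * real (card Y))" by (rule sum_mono) (rule deg)
  finally have K: "(\<Sum>y\<in>Y. k y) \<ge> m * real (card Y)" by (simp add: m_def mult_ac)
  \<comment> \<open>The assumption \<open>m \<ge> 2\<close> gives \<open>m - 1 \<ge> m / 2\<close>,
    which turns \<open>m * (m - 1) / 2\<close> into the cleaner quarter of the square.\<close>
  have "real (card Y) * m\<^sup>2 / 4 \<le> real (card Y) * (m * (m - 1) / 2)"
    using m2 by (subst times_divide_eq_right[symmetric], intro mult_left_mono)
      (auto simp: power2_eq_square field_simps)
  also have "\<dots> = (m - 1/2) * (m * real (card Y)) - real (card Y) * m\<^sup>2 / 2"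
    by (simp add: field_simps power2_eq_square)
  also have "\<dots> \<le> (m - 1/2) * (\<Sum>y\<in>Y. k y) - real (card Y) * m\<^sup>2 / 2"
    using mult_left_mono[OF K, of "m - 1/2"] m2 by simp
  also have "\<dots> = (\<Sum>y\<in>Y. (m - 1/2) * k y - m\<^sup>2 / 2)"
    by (simp add: sum_subtractf sum_distrib_left)
  \<comment> \<open>The summand on the left is the tangent at \<open>m\<close> to
    \<open>k * (k - 1) / 2\<close>; the difference is half the square of
    \<open>k y - m\<close>.\<close>
  also have "\<dots> \<le> (\<Sum>y\<in>Y. real (card {x\<in>U. R x y} choose 2))"
  proof (rule sum_mono)
    fix y
    have "0 \<le> (k y - m)\<^sup>2" by simp
    then show "(m - 1/2) * k y - m\<^sup>2 / 2 \<le> real (card {x\<in>U. R x y} choose 2)"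
      unfolding real_choose_two k_def[symmetric] by (simp add: power2_eq_square field_simps)
  qed
  also have "\<dots> = (\<Sum>p\<in>pairs U. real (card (common_nbrs R Y p)))"
    using sum_codeg_pairs[OF fin, of R] by (simp flip: of_nat_sum)
  finally show ?thesis by (simp add: m_def)
qed

section \<open>Random graphs whose edge probabilities are normalised codegrees\<close>

text \<open>
  A function \<open>g\<close> from pairs to \<open>Y\<close>, chosen uniformly, makes the pairs edges independently, the
  pair \<open>p\<close> with probability \<open>card (common_nbrs R Y p) / card Y\<close>.
\<close>
definition sampled_graph :: "('b \<Rightarrow> 'c \<Rightarrow> bool) \<Rightarrow> 'b set \<Rightarrow> ('b set \<Rightarrow> 'c) \<Rightarrow> 'b graph" where
  "sampled_graph R A g = Graph A {p \<in> pairs A. \<forall>x\<in>p. R x (g p)}"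

lemma simple_sampled_graph: "finite A \<Longrightarrow> simple_graph (sampled_graph R A g)"
  by (auto simp: simple_graph_def sampled_graph_def pairs_def)

text \<open>Chernoff's bound, with the exponential moment taken at \<open>1 / 2\<close>.\<close>
lemma sampled_graph_few_edges:
  fixes s :: real
  assumes "finite A" "finite Y" "Y \<noteq> {}" "U \<subseteq> A"
  shows "real (card {g \<in> pairs A \<rightarrow>\<^sub>E Y. real (card {e \<in> edges (sampled_graph R A g). e \<subseteq> U}) < s})
    \<le> real (card Y) ^ card (pairs A) *
        exp (s - (\<Sum>p\<in>pairs U. real (card (common_nbrs R Y p))) / (2 * real (card Y)))"
    (is "real (card ?B) \<le> _ * exp (s - ?\<mu> / _)")
proof -
  define n where "n = real (card Y)"
  have n: "n > 0" using assms by (simp add: n_def card_gt_0_iff)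
  let ?P = "pairs A"
  have finP: "finite ?P" using assms by (simp add: finite_pairs)
  have sub: "pairs U \<subseteq> ?P" using assms by (auto simp: pairs_def)
  define c where "c p = real (card (common_nbrs R Y p))" for p
  \<comment> \<open>The weight is 1/2 for each sampled edge inside \<open>U\<close> and 1 otherwise,
    so its product over all pairs is \<open>(1/2) ^ k\<close> for a graph with \<open>k\<close>
    edges inside \<open>U\<close>.\<close>
  define h where "h p y = (if p \<in> pairs U \<and> (\<forall>x\<in>p. R x y) then 1/2 else (1::real))" for p y
  have h0: "h p y > 0" for p y by (simp add: h_def)
  have prod_h: "(\<Prod>p\<in>?P. h p (g p)) = (1/2) ^ card {e \<in> edges (sampled_graph R A g). e \<subseteq> U}" for g
  proof -
    have eq: "{e \<in> edges (sampled_graph R A g). e \<subseteq> U} = {p \<in> ?P. p \<in> pairs U \<and> (\<forall>x\<in>p. R x (g p))}"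
      using assms(4) by (auto simp: sampled_graph_def pairs_def)
    show ?thesis unfolding eq h_def
      by (subst prod.inter_filter[symmetric, OF finP]) (rule prod_constant)
  qed
  have fing: "finite (?P \<rightarrow>\<^sub>E Y)" using finP assms by (simp add: finite_PiE)
  have "real (card ?B) = (\<Sum>g\<in>?B. 1)" by simp
  \<comment> \<open>Markov's inequality in counting form: a graph with \<open>k < s\<close> edges
    inside \<open>U\<close> has \<open>exp s * (1/2) ^ k \<ge> exp (s - k) \<ge> 1\<close>, because
    \<open>exp (- 1) \<le> 1/2\<close>.\<close>
  also have "\<dots> \<le> (\<Sum>g\<in>?B. exp s * (\<Prod>p\<in>?P. h p (g p)))"
  proof (rule sum_mono)
    fix g assume "g \<in> ?B"
    define k where "k = card {e \<in> edges (sampled_graph R A g). e \<subseteq> U}"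
    have k: "real k < s" using \<open>g \<in> ?B\<close> by (simp add: k_def)
    have "exp (- 1) \<le> (1/2::real)" using exp_ge_add_one_self[of "1::real"]
      by (simp add: exp_minus field_simps)
    then have "exp (- 1) ^ k \<le> (1/2::real) ^ k" by (rule power_mono) simp
    then have "exp (- real k) \<le> (1/2) ^ k" by (simp flip: exp_of_nat_mult)
    then have "exp s * (1/2)^k \<ge> exp s * exp (- real k)" by simp
    also have "exp s * exp (- real k) = exp (s - real k)" by (simp flip: exp_add)
    finally show "1 \<le> exp s * (\<Prod>p\<in>?P. h p (g p))"
      unfolding prod_h k_def[symmetric] using k one_le_exp_iff[of "s - real k"] by linarith
  qed
  also have "\<dots> \<le> (\<Sum>g\<in>?P \<rightarrow>\<^sub>E Y. exp s * (\<Prod>p\<in>?P. h p (g p)))"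
    using fing h0 by (intro sum_mono2 mult_nonneg_nonneg prod_nonneg) (auto simp: less_imp_le)
  \<comment> \<open>Independence of the pairs: the functions \<open>g\<close> range over a full
    product, so the sum of products factorises.\<close>
  also have "\<dots> = exp s * (\<Prod>p\<in>?P. \<Sum>y\<in>Y. h p y)"
    using finP assms by (simp add: prod_sum_PiE sum_distrib_left)
  also have "\<dots> \<le> exp s * (\<Prod>p\<in>?P. n * exp (if p \<in> pairs U then - c p / (2 * n) else 0))"
  proof (intro mult_left_mono prod_mono conjI)
    fix p
    show "0 \<le> (\<Sum>y\<in>Y. h p y)" using h0 by (intro sum_nonneg less_imp_le)
    show "(\<Sum>y\<in>Y. h p y) \<le> n * exp (if p \<in> pairs U then - c p / (2 * n) else 0)"
    proof (cases "p \<in> pairs U")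
      case True
      have "(\<Sum>y\<in>Y. h p y) = (\<Sum>y\<in>Y. 1 - (if \<forall>x\<in>p. R x y then 1/2 else 0))"
        using True by (intro sum.cong) (auto simp: h_def)
      also have "\<dots> = n - c p / 2"
        using assms by (simp add: sum_subtractf n_def c_def common_nbrs_def flip: sum.inter_filter)
      also have "\<dots> = n * (1 + - c p / (2 * n))" using n by (simp add: field_simps)
      also have "\<dots> \<le> n * exp (- c p / (2 * n))"
        using n exp_ge_add_one_self[of "- c p / (2 * n)"] by (intro mult_left_mono) simp_all
      finally show ?thesis using True by simp
    qed (simp add: h_def n_def)
  qed simp
  also have "\<dots> = exp s * (n ^ card ?P * exp (\<Sum>p\<in>?P. if p \<in> pairs U then - c p / (2 * n) else 0))"
    using finP by (simp add: prod.distrib exp_sum)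
  also have "(\<Sum>p\<in>?P. if p \<in> pairs U then - c p / (2 * n) else 0) = (\<Sum>p\<in>pairs U. - c p / (2 * n))"
    using finP sub by (simp add: sum.If_cases Int_absorb1 Int_def[symmetric] flip: sum.inter_restrict)
  also have "\<dots> = - ?\<mu> / (2 * n)" by (simp add: c_def sum_negf flip: sum_divide_distrib)
  also have "exp s * (n ^ card ?P * exp (- ?\<mu> / (2 * n))) = n ^ card ?P * exp (s - ?\<mu> / (2 * n))"
    by (simp add: exp_diff exp_minus field_simps)
  finally show ?thesis by (simp add: n_def)
qed

text \<open>Union bound over the sets \<open>U\<close> of the size that density speaks of. With
  \<open>N = card A\<close> there are at most \<open>exp N\<close> of them, and each fails with
  probability at most \<open>exp (- (N + 1))\<close>, so the total is at most
  \<open>exp (- 1) \<le> 1/2\<close>.\<close>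

lemma few_sampled_graphs_not_dense:
  fixes A :: "'b set"
  assumes fin: "finite A" "finite Y" "Y \<noteq> {}"
    and \<delta>: "0 < \<delta>" and \<rho>: "0 < \<rho>" "\<delta> * \<rho> \<le> 1"
    and deg: "\<And>x. x \<in> A \<Longrightarrow> real (card {y\<in>Y. R x y}) \<ge> \<delta> * real (card Y)"
    and big: "real (card A) \<ge> 32 / (\<delta> * \<rho>)\<^sup>2"
  shows "2 * real (card {g \<in> pairs A \<rightarrow>\<^sub>E Y. \<not> dense_graph \<rho> (\<delta>\<^sup>2 / 8) (sampled_graph R A g)})
    \<le> real (card Y) ^ card (pairs A)" (is "2 * real (card ?Bad) \<le> ?T")
proof -
  define N where "N = real (card A)"
  define c where "c = \<delta> * \<rho>"
  have c: "0 < c" "c \<le> 1" using \<delta> \<rho> by (auto simp: c_def)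
  have "32 \<le> c\<^sup>2 * N" using big c by (simp add: N_def c_def[symmetric] field_simps)
  moreover have "c\<^sup>2 \<le> c" using c by (simp add: power2_eq_square mult_left_le)
  moreover have N0: "N \<ge> 0" by (simp add: N_def)
  \<comment> \<open>The first bound makes the Chernoff exponent beat the number of subsets; the
    second supplies the size condition of \<open>sum_codeg_pairs_ge\<close>.\<close>
  ultimately have cN: "c\<^sup>2 * N \<ge> 32" "c * N \<ge> 2" using mult_right_mono[of "c\<^sup>2" c N] by linarith+
  have "c\<^sup>2 \<le> 1" using c by (simp add: power_le_one)
  then have N1: "N \<ge> 1" using cN N0 mult_right_mono[of "c\<^sup>2" 1 N] by linarith
  define s where "s U = \<delta>\<^sup>2 / 8 * real (card U choose 2)" for U :: "'b set"
  define B where "B U = {g \<in> pairs A \<rightarrow>\<^sub>E Y. real (card {e \<in> edges (sampled_graph R A g). e \<subseteq> U}) < s U}" for U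
  define \<U> where "\<U> = {U. U \<subseteq> A \<and> real (card U) \<ge> \<rho> * N}"
  have fin\<U>: "finite \<U>" unfolding \<U>_def by (rule finite_subset[of _ "Pow A"]) (use fin in auto)
  have T0: "?T \<ge> 0" by simp
  have B: "real (card (B U)) \<le> ?T * exp (- (N + 1))" if "U \<in> \<U>" for U
  proof -
    define u where "u = real (card U)"
    have U: "U \<subseteq> A" "u \<ge> \<rho> * N" using that by (auto simp: \<U>_def u_def)
    have finU: "finite U" using U fin finite_subset by blast
    have du: "\<delta> * u \<ge> c * N" using mult_left_mono[OF U(2), of \<delta>] \<delta> by (simp add: c_def mult_ac)
    have "real (card Y) * (\<delta> * u)\<^sup>2 / 4 \<le> (\<Sum>p\<in>pairs U. real (card (common_nbrs R Y p)))" (is "_ \<le> ?\<mu>")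
      unfolding u_def
      by (rule sum_codeg_pairs_ge) (use finU fin deg U du cN in \<open>auto simp: u_def\<close>)
    moreover have n: "real (card Y) > 0" using fin by (simp add: card_gt_0_iff)
    ultimately have mu: "?\<mu> / (2 * real (card Y)) \<ge> (\<delta> * u)\<^sup>2 / 8"
      by (simp add: field_simps)
    have "s U \<le> \<delta>\<^sup>2 / 8 * (u\<^sup>2 / 2)"
      unfolding s_def real_choose_two u_def
      by (intro mult_left_mono) (auto simp: power2_eq_square algebra_simps)
    then have "s U \<le> (\<delta> * u)\<^sup>2 / 16" by (simp add: power_mult_distrib)
    moreover have "(\<delta> * u)\<^sup>2 \<ge> (c * N)\<^sup>2" using du cN by (intro power_mono) auto
    moreover have "(c * N)\<^sup>2 \<ge> 32 * N" using mult_right_mono[OF cN(1) N0]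
      by (simp add: power_mult_distrib power2_eq_square mult_ac)
    \<comment> \<open>The threshold \<open>s U\<close> is at most half of the Chernoff term, so the
      exponent is at most minus a sixteenth of the square of \<open>\<delta> * u\<close>. That is at
      most \<open>- 2 * N\<close>, which is where the constant 32 is spent.\<close>
    ultimately have "s U - ?\<mu> / (2 * real (card Y)) \<le> - (N + 1)" using mu N1 by linarith
    then have "?T * exp (s U - ?\<mu> / (2 * real (card Y))) \<le> ?T * exp (- (N + 1))"
      by (intro mult_left_mono) auto
    with sampled_graph_few_edges[OF fin U(1), of R "s U"] show ?thesis
      unfolding B_def by linarith
  qed
  have "?Bad \<subseteq> (\<Union>U\<in>\<U>. B U)"
    by (auto simp: dense_graph_def B_def \<U>_def s_def N_def sampled_graph_def not_le)
  moreover have "finite (\<Union>U\<in>\<U>. B U)"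
    using fin\<U> fin by (auto simp: B_def finite_pairs finite_PiE)
  ultimately have "card ?Bad \<le> card (\<Union>U\<in>\<U>. B U)" by (rule card_mono[rotated])
  also have "\<dots> \<le> (\<Sum>U\<in>\<U>. card (B U))" by (rule card_UN_le[OF fin\<U>])
  finally have "real (card ?Bad) \<le> (\<Sum>U\<in>\<U>. real (card (B U)))" by (simp flip: of_nat_sum)
  also have "\<dots> \<le> real (card \<U>) * (?T * exp (- (N + 1)))" by (rule sum_bounded_above) (rule B)
  also have "\<dots> \<le> exp N * (?T * exp (- (N + 1)))"
  proof (rule mult_right_mono)
    have "card \<U> \<le> card (Pow A)" using fin by (intro card_mono) (auto simp: \<U>_def)
    then have "card \<U> \<le> 2 ^ card A" using fin by (simp add: card_Pow)
    then have "real (card \<U>) \<le> 2 ^ card A" by (metis of_nat_le_iff of_nat_numeral of_nat_power)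
    also have "\<dots> \<le> exp 1 ^ card A" using exp_ge_add_one_self[of "1::real"] by (intro power_mono) auto
    also have "\<dots> = exp N" by (simp add: N_def flip: exp_of_nat_mult)
    finally show "real (card \<U>) \<le> exp N" .
  qed auto
  also have "\<dots> = ?T * (exp N * exp (- (N + 1)))" by (simp only: mult_ac)
  also have "exp N * exp (- (N + 1)) = exp (- 1)" by (simp flip: exp_add)
  also have "?T * exp (- 1) \<le> ?T * (1/2)" using exp_ge_add_one_self[of "1::real"]
    by (intro mult_left_mono) (auto simp: exp_minus field_simps)
  finally show ?thesis by simp
qed

section \<open>The expected number of copies in the random graph\<close>

lemma codeg_count_nonneg: "codeg_count V E R X Y \<ge> 0"
  unfolding codeg_count_def by (intro sum_nonneg prod_nonneg) auto

text \<open>Linearity of expectation. An injective map sends distinct edges of \<open>H\<close> to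
  distinct pairs, whose presence is independent, so it is a copy with probability the product of the
  normalised codegrees. Powers of \<open>card Y\<close> clear the denominators.\<close>

lemma sum_labelled_copies_sampled_graph_le:
  assumes H: "simple_graph H" and fin: "finite A" "finite Y" "Y \<noteq> {}"
  shows "(\<Sum>g\<in>pairs A \<rightarrow>\<^sub>E Y. real (card (labelled_copies H (sampled_graph R A g)))) * real (card Y) ^ card (edges H)
    \<le> real (card Y) ^ card (pairs A) * codeg_count (verts H) (edges H) R A Y"
proof -
  let ?P = "pairs A" and ?V = "verts H" and ?E = "edges H" and ?n = "card Y"
  define \<Phi> where "\<Phi> = {\<phi> \<in> ?V \<rightarrow>\<^sub>E A. inj_on \<phi> ?V}"
  have finV: "finite ?V" and E: "\<And>e. e \<in> ?E \<Longrightarrow> e \<subseteq> ?V \<and> card e = 2"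
    using H by (auto simp: simple_graph_def)
  have fin\<Phi>': "finite (?V \<rightarrow>\<^sub>E A)" using finV fin by (simp add: finite_PiE)
  then have fin\<Phi>: "finite \<Phi>" by (simp add: \<Phi>_def)
  have finP: "finite ?P" using fin by (simp add: finite_pairs)
  have fing: "finite (?P \<rightarrow>\<^sub>E Y)" using finP fin by (simp add: finite_PiE)
  have finE: "finite ?E" using E finV by (intro finite_subset[of ?E "Pow ?V"]) auto
  have cg: "card {g \<in> ?P \<rightarrow>\<^sub>E Y. \<forall>e\<in>?E. \<phi> ` e \<in> edges (sampled_graph R A g)} * ?n ^ card ?E
     = ?n ^ card ?P * (\<Prod>e\<in>?E. card (common_nbrs R Y (\<phi> ` e)))" if \<phi>: "\<phi> \<in> \<Phi>" for \<phi>
  proof -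
    let ?F = "(`) \<phi> ` ?E"
    have inj: "inj_on \<phi> ?V" and ran: "\<phi> ` ?V \<subseteq> A" using \<phi> by (auto simp: \<Phi>_def)
    have im: "\<phi> ` e \<in> ?P" if "e \<in> ?E" for e
      using E[OF that] inj ran by (auto simp: pairs_def card_image inj_on_subset)
    have injF: "inj_on ((`) \<phi>) ?E"
      by (rule inj_onI) (metis E inj inj_on_image_eq_iff)
    have FP: "?F \<subseteq> ?P" using im by auto
    \<comment> \<open>For a fixed \<open>\<phi>\<close> the good choice functions again form a
      product: on the image of an edge the value must be a common neighbour, on every other pair it
      is free.\<close>
    have "{g \<in> ?P \<rightarrow>\<^sub>E Y. \<forall>e\<in>?E. \<phi> ` e \<in> edges (sampled_graph R A g)}
        = PiE ?P (\<lambda>p. if p \<in> ?F then common_nbrs R Y p else Y)" (is "_ = PiE _ ?Z")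
    proof (intro set_eqI iffI)
      fix g assume "g \<in> {g \<in> ?P \<rightarrow>\<^sub>E Y. \<forall>e\<in>?E. \<phi> ` e \<in> edges (sampled_graph R A g)}"
      then show "g \<in> PiE ?P ?Z" by (auto simp: sampled_graph_def common_nbrs_def PiE_iff)
    next
      fix g assume g: "g \<in> PiE ?P ?Z"
      have "g (\<phi> ` e) \<in> common_nbrs R Y (\<phi> ` e)" if "e \<in> ?E" for e
        using PiE_mem[OF g im[OF that]] that by auto
      moreover have "g p \<in> Y" if "p \<in> ?P" for p
        using PiE_mem[OF g that] by (auto simp: common_nbrs_def split: if_splits)
      ultimately show "g \<in> {g \<in> ?P \<rightarrow>\<^sub>E Y. \<forall>e\<in>?E. \<phi> ` e \<in> edges (sampled_graph R A g)}"
        using g im by (auto simp: sampled_graph_def common_nbrs_def PiE_iff)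
    qed
    then have "card {g \<in> ?P \<rightarrow>\<^sub>E Y. \<forall>e\<in>?E. \<phi> ` e \<in> edges (sampled_graph R A g)}
        = (\<Prod>p\<in>?P. card (?Z p))" using finP by (simp add: card_PiE)
    also have "\<dots> = (\<Prod>p\<in>?P - ?F. card (?Z p)) * (\<Prod>p\<in>?F. card (?Z p))"
      by (rule prod.subset_diff[OF FP finP])
    also have "(\<Prod>p\<in>?P - ?F. card (?Z p)) = ?n ^ card (?P - ?F)" by simp
    also have "(\<Prod>p\<in>?F. card (?Z p)) = (\<Prod>e\<in>?E. card (common_nbrs R Y (\<phi> ` e)))"
      using injF by (simp add: prod.reindex)
    finally have "card {g \<in> ?P \<rightarrow>\<^sub>E Y. \<forall>e\<in>?E. \<phi> ` e \<in> edges (sampled_graph R A g)} * ?n ^ card ?E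
      = ?n ^ (card (?P - ?F) + card ?E) * (\<Prod>e\<in>?E. card (common_nbrs R Y (\<phi> ` e)))"
      by (simp add: power_add mult_ac)
    moreover have "card (?P - ?F) + card ?E = card ?P"
      using card_Diff_subset[of ?F ?P] card_mono[OF finP FP] FP finE card_image[OF injF] by simp
    ultimately show ?thesis by simp
  qed
  have "labelled_copies H (sampled_graph R A g) = {\<phi> \<in> \<Phi>. \<forall>e\<in>?E. \<phi> ` e \<in> edges (sampled_graph R A g)}" for g
    by (auto simp: labelled_copies_def homs_def \<Phi>_def sampled_graph_def)
  then have "(\<Sum>g\<in>?P \<rightarrow>\<^sub>E Y. card (labelled_copies H (sampled_graph R A g)))
     = (\<Sum>\<phi>\<in>\<Phi>. card {g \<in> ?P \<rightarrow>\<^sub>E Y. \<forall>e\<in>?E. \<phi> ` e \<in> edges (sampled_graph R A g)})"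
    using sum_multicount_gen[OF fing fin\<Phi>,
        of "\<lambda>g \<phi>. \<forall>e\<in>?E. \<phi> ` e \<in> edges (sampled_graph R A g)"] by simp
  then have "(\<Sum>g\<in>?P \<rightarrow>\<^sub>E Y. card (labelled_copies H (sampled_graph R A g))) * ?n ^ card ?E
     = (\<Sum>\<phi>\<in>\<Phi>. ?n ^ card ?P * (\<Prod>e\<in>?E. card (common_nbrs R Y (\<phi> ` e))))"
    using cg by (simp add: sum_distrib_right)
  \<comment> \<open>The maps that are not injective are added here; their contributions are
    nonnegative.\<close>
  also have "\<dots> \<le> (\<Sum>\<phi>\<in>?V \<rightarrow>\<^sub>E A. ?n ^ card ?P * (\<Prod>e\<in>?E. card (common_nbrs R Y (\<phi> ` e))))"
    using fin\<Phi>' by (intro sum_mono2) (auto simp: \<Phi>_def)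
  finally have "real ((\<Sum>g\<in>?P \<rightarrow>\<^sub>E Y. card (labelled_copies H (sampled_graph R A g))) * ?n ^ card ?E)
    \<le> real (\<Sum>\<phi>\<in>?V \<rightarrow>\<^sub>E A. ?n ^ card ?P * (\<Prod>e\<in>?E. card (common_nbrs R Y (\<phi> ` e))))"
    by (rule of_nat_mono)
  then show ?thesis by (simp add: codeg_count_def sum_distrib_left)
qed

text \<open>At least half of the choice functions give a dense graph, and each of these contains the
  assumed number of copies; comparison with the upper bound on the total yields the claim. The
  elements of \<open>A\<close> are natural numbers to match the type of the graphs in the hypothesis
  on copies.\<close>

lemma codeg_count_ge_if_large:
  fixes A :: "nat set"
  assumes H: "simple_graph H" and fin: "finite A" "finite Y" "Y \<noteq> {}"
    and \<delta>: "0 < \<delta>" and \<rho>: "0 < \<rho>" "\<delta> * \<rho> \<le> 1" and a: "a > 0"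
    and deg: "\<And>x. x \<in> A \<Longrightarrow> real (card {y\<in>Y. R x y}) \<ge> \<delta> * real (card Y)"
    and big: "real (card A) \<ge> 32 / (\<delta> * \<rho>)\<^sup>2"
    and copies: "\<And>G :: nat graph. simple_graph G \<Longrightarrow> card (verts G) = card A \<Longrightarrow>
      dense_graph \<rho> (\<delta>\<^sup>2 / 8) G \<Longrightarrow>
      real (card (labelled_copies H G)) \<ge> a * real (card A) ^ card (verts H) * (\<delta>\<^sup>2 / 8) ^ card (edges H)"
  shows "codeg_count (verts H) (edges H) R A Y \<ge>
    a / 2 * real (card A) ^ card (verts H) * (\<delta>\<^sup>2 / 8 * real (card Y)) ^ card (edges H)"
proof -
  let ?P = "pairs A" and ?n = "real (card Y)" and ?S = "sampled_graph R A"
  define L where "L = a * real (card A) ^ card (verts H) * (\<delta>\<^sup>2 / 8) ^ card (edges H)"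
  have L0: "L \<ge> 0" using a by (simp add: L_def)
  let ?D = "{g \<in> ?P \<rightarrow>\<^sub>E Y. dense_graph \<rho> (\<delta>\<^sup>2 / 8) (?S g)}"
  let ?B = "{g \<in> ?P \<rightarrow>\<^sub>E Y. \<not> dense_graph \<rho> (\<delta>\<^sup>2 / 8) (?S g)}"
  have finP: "finite ?P" using fin by (simp add: finite_pairs)
  have fing: "finite (?P \<rightarrow>\<^sub>E Y)" using finP fin by (simp add: finite_PiE)
  have n: "?n > 0" using fin by (simp add: card_gt_0_iff)
  have "card (?P \<rightarrow>\<^sub>E Y) = card ?D + card ?B"
    using fing by (subst card_Un_disjoint[symmetric]) (auto intro!: arg_cong[where f=card])
  then have "?n ^ card ?P = real (card ?D) + real (card ?B)"
    using finP by (simp add: card_PiE flip: of_nat_power of_nat_add)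
  moreover have "2 * real (card ?B) \<le> ?n ^ card ?P"
    using fin \<delta> \<rho> deg big by (rule few_sampled_graphs_not_dense)
  ultimately have "?n ^ card ?P / 2 \<le> real (card ?D)" by linarith
  then have "?n ^ card ?P / 2 * L \<le> real (card ?D) * L" using L0 by (rule mult_right_mono)
  also have "\<dots> = (\<Sum>g\<in>?D. L)" by simp
  also have "\<dots> \<le> (\<Sum>g\<in>?D. real (card (labelled_copies H (?S g))))"
  proof (rule sum_mono)
    fix g assume "g \<in> ?D"
    then show "L \<le> real (card (labelled_copies H (?S g)))"
      unfolding L_def using fin
      by (intro copies simple_sampled_graph) (auto simp: sampled_graph_def)
  qed
  also have "\<dots> \<le> (\<Sum>g\<in>?P \<rightarrow>\<^sub>E Y. real (card (labelled_copies H (?S g))))"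
    using fing by (intro sum_mono2) auto
  finally have "?n ^ card ?P / 2 * L * ?n ^ card (edges H) \<le>
      (\<Sum>g\<in>?P \<rightarrow>\<^sub>E Y. real (card (labelled_copies H (?S g)))) * ?n ^ card (edges H)"
    by (rule mult_right_mono) simp
  also have "\<dots> \<le> ?n ^ card ?P * codeg_count (verts H) (edges H) R A Y"
    using H fin by (rule sum_labelled_copies_sampled_graph_le)
  finally have "?n ^ card ?P * (L / 2 * ?n ^ card (edges H)) \<le> ?n ^ card ?P * codeg_count (verts H) (edges H) R A Y"
    by (simp add: mult_ac)
  then have "L / 2 * ?n ^ card (edges H) \<le> codeg_count (verts H) (edges H) R A Y"
    using n by (simp add: mult_le_cancel_left_pos)
  then show ?thesis by (simp only: L_def power_mult_distrib) (simp add: mult_ac)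
qed

section \<open>Blow-ups, isolated vertices and tensor powers\<close>

lemma sum_const_fibres:
  fixes F :: "'d \<Rightarrow> real"
  assumes "finite S" "finite T" "g ` S \<subseteq> T" "\<And>y. y \<in> T \<Longrightarrow> card {x\<in>S. g x = y} = c"
  shows "(\<Sum>x\<in>S. F (g x)) = real c * (\<Sum>y\<in>T. F y)"
proof -
  have "(\<Sum>x\<in>S. F (g x)) = (\<Sum>y\<in>T. of_nat (card {x\<in>S. g x = y}) * F y)"
    using assms(1-3) by (rule sum_fun_comp)
  also have "\<dots> = (\<Sum>y\<in>T. real c * F y)" using assms(4) by (intro sum.cong) auto
  finally show ?thesis by (simp add: sum_distrib_left)
qed

text \<open>The product depends on a map only through its composition with \<open>h\<close>, and
  each map into \<open>X\<close> has \<open>L ^ card V\<close> lifts. The identity is exact because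
  maps need not be injective.\<close>

lemma codeg_count_blow_up:
  assumes fin: "finite V" "finite X" "finite X'" and E: "\<And>e. e \<in> E \<Longrightarrow> e \<subseteq> V"
    and h: "h ` X' \<subseteq> X" and fib: "\<And>x. x \<in> X \<Longrightarrow> card {x'\<in>X'. h x' = x} = L"
  shows "codeg_count V E (\<lambda>x. R (h x)) X' Y = real L ^ card V * codeg_count V E R X Y"
proof -
  define g where "g \<phi> = restrict (h \<circ> \<phi>) V" for \<phi>
  define F where "F \<psi> = (\<Prod>e\<in>E. real (card (common_nbrs R Y (\<psi> ` e))))" for \<psi>
  have "common_nbrs (\<lambda>x. R (h x)) Y (\<phi> ` e) = common_nbrs R Y (g \<phi> ` e)" if "e \<in> E" for \<phi> e
    using E[OF that] by (auto simp: common_nbrs_def g_def subset_iff)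
  then have "codeg_count V E (\<lambda>x. R (h x)) X' Y = (\<Sum>\<phi>\<in>V \<rightarrow>\<^sub>E X'. F (g \<phi>))"
    by (simp add: codeg_count_def F_def)
  also have "\<dots> = real (L ^ card V) * (\<Sum>\<psi>\<in>V \<rightarrow>\<^sub>E X. F \<psi>)"
  proof (rule sum_const_fibres)
    show "g ` (V \<rightarrow>\<^sub>E X') \<subseteq> V \<rightarrow>\<^sub>E X" using h by (auto simp: g_def PiE_iff)
    fix \<psi> assume \<psi>: "\<psi> \<in> V \<rightarrow>\<^sub>E X"
    have "{\<phi> \<in> V \<rightarrow>\<^sub>E X'. g \<phi> = \<psi>} = PiE V (\<lambda>v. {x'\<in>X'. h x' = \<psi> v})"
    proof (intro set_eqI iffI)
      fix \<phi> assume "\<phi> \<in> {\<phi> \<in> V \<rightarrow>\<^sub>E X'. g \<phi> = \<psi>}"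
      then show "\<phi> \<in> PiE V (\<lambda>v. {x'\<in>X'. h x' = \<psi> v})" by (auto simp: g_def PiE_iff)
    next
      fix \<phi> assume \<phi>: "\<phi> \<in> PiE V (\<lambda>v. {x'\<in>X'. h x' = \<psi> v})"
      have "g \<phi> v = \<psi> v" for v using \<phi> \<psi> by (cases "v \<in> V") (auto simp: g_def PiE_iff extensional_def)
      then show "\<phi> \<in> {\<phi> \<in> V \<rightarrow>\<^sub>E X'. g \<phi> = \<psi>}" using \<phi> by (auto simp: PiE_iff)
    qed
    moreover have "(\<Prod>v\<in>V. card {x'\<in>X'. h x' = \<psi> v}) = (\<Prod>v\<in>V. L)"
      by (rule prod.cong) (use fib \<psi> in auto)
    ultimately show "card {\<phi> \<in> V \<rightarrow>\<^sub>E X'. g \<phi> = \<psi>} = L ^ card V"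
      using fin by (simp add: card_PiE)
  qed (use fin in \<open>auto simp: finite_PiE\<close>)
  finally show ?thesis by (simp add: codeg_count_def F_def)
qed

text \<open>Vertices outside \<open>W\<close> lie on no edge, so their images are arbitrary elements
  of \<open>X\<close>.\<close>

lemma codeg_count_isolated:
  assumes fin: "finite V" "finite X" and W: "W \<subseteq> V" and E: "\<And>e. e \<in> E \<Longrightarrow> e \<subseteq> W"
  shows "codeg_count V E R X Y = real (card X) ^ card (V - W) * codeg_count W E R X Y"
proof -
  define F where "F \<psi> = (\<Prod>e\<in>E. real (card (common_nbrs R Y (\<psi> ` e))))" for \<psi>
  have finW: "finite W" using fin W finite_subset by blast
  have "common_nbrs R Y (\<phi> ` e) = common_nbrs R Y (restrict \<phi> W ` e)" if "e \<in> E" for \<phi> e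
    using E[OF that] by (auto simp: common_nbrs_def subset_iff)
  then have "codeg_count V E R X Y = (\<Sum>\<phi>\<in>V \<rightarrow>\<^sub>E X. F (restrict \<phi> W))"
    by (simp add: codeg_count_def F_def)
  also have "\<dots> = real (card X ^ card (V - W)) * (\<Sum>\<psi>\<in>W \<rightarrow>\<^sub>E X. F \<psi>)"
  proof (rule sum_const_fibres)
    show "(\<lambda>\<phi>. restrict \<phi> W) ` (V \<rightarrow>\<^sub>E X) \<subseteq> W \<rightarrow>\<^sub>E X" using W by (auto simp: PiE_iff)
    fix \<psi> assume \<psi>: "\<psi> \<in> W \<rightarrow>\<^sub>E X"
    let ?B = "\<lambda>v. if v \<in> W then {\<psi> v} else X"
    have "{\<phi> \<in> V \<rightarrow>\<^sub>E X. restrict \<phi> W = \<psi>} = PiE V ?B"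
    proof (intro set_eqI iffI)
      fix \<phi> assume "\<phi> \<in> {\<phi> \<in> V \<rightarrow>\<^sub>E X. restrict \<phi> W = \<psi>}"
      then show "\<phi> \<in> PiE V ?B" by (auto simp: PiE_iff)
    next
      fix \<phi> assume \<phi>: "\<phi> \<in> PiE V ?B"
      have mem: "\<phi> v \<in> (if v \<in> W then {\<psi> v} else X)" if "v \<in> V" for v using PiE_mem[OF \<phi> that] by simp
      have "restrict \<phi> W v = \<psi> v" for v
        using mem[of v] W \<psi> by (cases "v \<in> W") (auto simp: PiE_iff extensional_def)
      moreover have "\<phi> v \<in> X" if "v \<in> V" for v
        using mem[OF that] \<psi> by (auto simp: PiE_iff split: if_splits)
      ultimately show "\<phi> \<in> {\<phi> \<in> V \<rightarrow>\<^sub>E X. restrict \<phi> W = \<psi>}" using \<phi> by (auto simp: PiE_iff)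
    qed
    then have "card {\<phi> \<in> V \<rightarrow>\<^sub>E X. restrict \<phi> W = \<psi>} = (\<Prod>v\<in>V. card (?B v))"
      using fin by (simp add: card_PiE)
    also have "\<dots> = (\<Prod>v\<in>V - W. card (?B v)) * (\<Prod>v\<in>W. card (?B v))"
      by (rule prod.subset_diff[OF W fin(1)])
    finally show "card {\<phi> \<in> V \<rightarrow>\<^sub>E X. restrict \<phi> W = \<psi>} = card X ^ card (V - W)" by simp
  qed (use fin finW in \<open>auto simp: finite_PiE\<close>)
  finally show ?thesis by (simp add: codeg_count_def F_def)
qed

lemma codeg_count_mono:
  assumes "finite V" "finite X" "A \<subseteq> X"
  shows "codeg_count V E R A Y \<le> codeg_count V E R X Y"
  unfolding codeg_count_def
  by (rule sum_mono2) (use assms in \<open>auto simp: finite_PiE prod_nonneg PiE_iff\<close>)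

text \<open>A map from \<open>V\<close> to \<open>k\<close>-tuples is a \<open>k\<close>-tuple of
  maps, and common neighbourhoods in the power are products of those in the coordinates. Injectivity
  of the transposition \<open>tr\<close> is enough for the upper bound.\<close>

lemma codeg_count_tensor_power:
  assumes fin: "finite V" "finite X" "finite Y" and E: "\<And>e. e \<in> E \<Longrightarrow> e \<subseteq> V"
  shows "codeg_count V E (\<lambda>x y. \<forall>i<k. R (x i) (y i)) ({..<k} \<rightarrow>\<^sub>E X) ({..<k} \<rightarrow>\<^sub>E Y)
    \<le> codeg_count V E R X Y ^ k"
proof -
  define F where "F \<psi> = (\<Prod>e\<in>E. real (card (common_nbrs R Y (\<psi> ` e))))" for \<psi>
  define tr where "tr \<Phi> = (\<lambda>i\<in>{..<k}. \<lambda>v\<in>V. \<Phi> v i)" for \<Phi> :: "'a \<Rightarrow> nat \<Rightarrow> 'b"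
  let ?Xk = "{..<k} \<rightarrow>\<^sub>E X" and ?Rk = "\<lambda>x y. \<forall>i<k. R (x i) (y i)"
  have cn: "card (common_nbrs ?Rk ({..<k} \<rightarrow>\<^sub>E Y) (\<Phi> ` e)) = (\<Prod>i<k. card (common_nbrs R Y (tr \<Phi> i ` e)))"
    if "e \<in> E" for \<Phi> e
  proof -
    have "common_nbrs ?Rk ({..<k} \<rightarrow>\<^sub>E Y) (\<Phi> ` e) = PiE {..<k} (\<lambda>i. common_nbrs R Y (tr \<Phi> i ` e))"
      using E[OF that] by (auto simp: common_nbrs_def tr_def subset_iff PiE_iff extensional_def)
    then show ?thesis by (simp add: card_PiE)
  qed
  have prodF: "(\<Prod>e\<in>E. real (card (common_nbrs ?Rk ({..<k} \<rightarrow>\<^sub>E Y) (\<Phi> ` e)))) = (\<Prod>i<k. F (tr \<Phi> i))" for \<Phi>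
    unfolding F_def by (subst prod.swap) (simp add: cn)
  have inj: "inj_on tr (V \<rightarrow>\<^sub>E ?Xk)"
  proof (rule inj_onI)
    fix \<Phi> \<Psi> assume \<Phi>: "\<Phi> \<in> V \<rightarrow>\<^sub>E ?Xk" and \<Psi>: "\<Psi> \<in> V \<rightarrow>\<^sub>E ?Xk" and eq: "tr \<Phi> = tr \<Psi>"
    show "\<Phi> = \<Psi>"
    proof (rule PiE_ext[OF \<Phi> \<Psi>])
      fix v assume v: "v \<in> V"
      show "\<Phi> v = \<Psi> v"
      proof (rule PiE_ext[OF PiE_mem[OF \<Phi> v] PiE_mem[OF \<Psi> v]])
        fix i assume "i \<in> {..<k}"
        then show "\<Phi> v i = \<Psi> v i" using fun_cong[OF fun_cong[OF eq, of i], of v] v by (simp add: tr_def)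
      qed
    qed
  qed
  have F0: "F \<psi> \<ge> 0" for \<psi> by (simp add: F_def prod_nonneg)
  have "codeg_count V E ?Rk ?Xk ({..<k} \<rightarrow>\<^sub>E Y) = (\<Sum>\<Phi>\<in>V \<rightarrow>\<^sub>E ?Xk. \<Prod>i<k. F (tr \<Phi> i))"
    by (simp add: codeg_count_def prodF)
  also have "\<dots> = (\<Sum>\<Psi>\<in>tr ` (V \<rightarrow>\<^sub>E ?Xk). \<Prod>i<k. F (\<Psi> i))"
    using inj by (simp add: sum.reindex)
  also have "\<dots> \<le> (\<Sum>\<Psi>\<in>{..<k} \<rightarrow>\<^sub>E (V \<rightarrow>\<^sub>E X). \<Prod>i<k. F (\<Psi> i))"
  proof (rule sum_mono2)
    show "tr ` (V \<rightarrow>\<^sub>E ?Xk) \<subseteq> {..<k} \<rightarrow>\<^sub>E (V \<rightarrow>\<^sub>E X)"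
      by (auto simp: tr_def PiE_iff)
  qed (use fin F0 in \<open>auto simp: finite_PiE prod_nonneg\<close>)
  also have "\<dots> = (\<Prod>i<k. \<Sum>\<psi>\<in>V \<rightarrow>\<^sub>E X. F \<psi>)"
    using fin by (subst prod_sum_PiE) (auto simp: finite_PiE)
  finally show ?thesis by (simp add: codeg_count_def F_def)
qed

section \<open>Residue classes, removal of subexponential factors and degree thresholds\<close>

lemma card_mod_fibre:
  fixes n L r :: nat
  assumes "r < n"
  shows "card {i \<in> {..<n * L}. i mod n = r} = L"
proof -
  have "{i \<in> {..<n * L}. i mod n = r} = (\<lambda>q. r + n * q) ` {..<L}"
  proof (intro set_eqI iffI)
    fix i assume i: "i \<in> {i \<in> {..<n * L}. i mod n = r}"
    then have "i div n < L" by (simp add: less_mult_imp_div_less mult.commute)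
    moreover have "i = r + n * (i div n)" using i by auto
    ultimately show "i \<in> (\<lambda>q. r + n * q) ` {..<L}" by blast
  next
    fix i assume "i \<in> (\<lambda>q. r + n * q) ` {..<L}"
    then obtain q where q: "q < L" "i = r + n * q" by auto
    then have "n * Suc q \<le> n * L" by (intro mult_le_mono2) simp
    then show "i \<in> {i \<in> {..<n * L}. i mod n = r}" using q assms by auto
  qed
  moreover have "inj_on (\<lambda>q. r + n * q) {..<L}" using assms by (auto simp: inj_on_def)
  ultimately show ?thesis by (simp add: card_image)
qed

text \<open>This is the limiting step of the tensor power trick: if \<open>B\<close> exceeded
  \<open>T\<close>, the exponential decay of \<open>(T / B) ^ k\<close> would beat the polynomial
  factor and fall below \<open>c\<close>.\<close>

lemma le_of_polynomial_factor:
  fixes B T c L :: real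
  assumes c: "c > 0" and T: "T \<ge> 0" and L: "L \<ge> 0"
    and le: "\<And>k::nat. k \<ge> 1 \<Longrightarrow> c * B ^ k \<le> T ^ k * (1 + real k * L) ^ m"
  shows "B \<le> T"
proof (rule ccontr)
  assume "\<not> B \<le> T"
  then have B: "B > T" "B > 0" using T by auto
  define q where "q = T / B"
  have q: "0 \<le> q" "q < 1" using B T by (auto simp: q_def)
  \<comment> \<open>Taking an \<open>M\<close>-th root reduces everything to the limit of
    \<open>k * x ^ k\<close>. The successor keeps the root index positive when
    \<open>m = 0\<close>.\<close>
  define M where "M = Suc m"
  define x where "x = root M q"
  have x: "0 \<le> x" "x < 1" and xM: "x ^ M = q"
    using q real_root_pow_pos2[of M q] by (auto simp: x_def M_def simp del: power_Suc)
  have "(\<lambda>k. real k * x ^ k) \<longlonglongrightarrow> 0" using x by (intro powser_times_n_limit_0) auto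
  then have "(\<lambda>k. ((real k * x ^ k) * (1 + L)) ^ M) \<longlonglongrightarrow> (0 * (1 + L)) ^ M" by (intro tendsto_intros)
  then have "(\<lambda>k. ((real k * x ^ k) * (1 + L)) ^ M) \<longlonglongrightarrow> 0" by (simp add: M_def)
  then have "\<forall>\<^sub>F k in sequentially. ((real k * x ^ k) * (1 + L)) ^ M < c"
    using c by (rule order_tendstoD)
  then obtain k where k: "k \<ge> 1" "((real k * x ^ k) * (1 + L)) ^ M < c"
    using eventually_happens[OF eventually_conj[OF _ eventually_ge_at_top[of "1::nat"]]] by auto
  have "c * B ^ k \<le> T ^ k * (1 + real k * L) ^ m" by (rule le[OF k(1)])
  then have "c \<le> q ^ k * (1 + real k * L) ^ m"
    using B by (simp add: q_def power_divide field_simps)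
  also have "\<dots> \<le> q ^ k * (1 + real k * L) ^ M"
    using L q by (intro mult_left_mono power_increasing) (auto simp: M_def)
  \<comment> \<open>Here \<open>k \<ge> 1\<close> gives
    \<open>1 + k * L \<le> k * (1 + L)\<close>.\<close>
  also have "\<dots> \<le> q ^ k * (real k * (1 + L)) ^ M"
    using L q k by (intro mult_left_mono power_mono) (auto simp: algebra_simps)
  also have "q ^ k = (x ^ k) ^ M" by (simp add: xM mult.commute flip: xM power_mult)
  also have "(x ^ k) ^ M * (real k * (1 + L)) ^ M = ((real k * x ^ k) * (1 + L)) ^ M"
    by (simp add: power_mult_distrib mult_ac)
  finally show False using k by simp
qed

text \<open>The sum of the degrees is the sum over \<open>j\<close> of the sizes of the level sets
  \<open>{x\<in>X. j \<le> d x}\<close>. If every threshold failed, the \<open>j\<close>-th set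
  would have size below \<open>S / (j * harm N)\<close>, and these bounds add up to only
  \<open>S\<close>.\<close>

lemma exists_degree_threshold:
  fixes d :: "'b \<Rightarrow> nat"
  assumes "finite X" "\<And>x. x \<in> X \<Longrightarrow> d x \<le> N"
  shows "(\<Sum>x\<in>X. real (d x)) = 0 \<or>
    (\<exists>j\<in>{1..N}. real j * real (card {x\<in>X. j \<le> d x}) * harm N \<ge> (\<Sum>x\<in>X. real (d x)))"
proof (rule ccontr)
  define S where "S = (\<Sum>x\<in>X. real (d x))"
  let ?A = "\<lambda>j. {x\<in>X. j \<le> d x}"
  assume "\<not> ?thesis"
  then have S: "S \<noteq> 0" and lt: "\<And>j. j \<in> {1..N} \<Longrightarrow> real j * real (card (?A j)) * harm N < S"
    by (auto simp: S_def not_le)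
  have "(\<Sum>x\<in>X. card {j\<in>{1..N}. j \<le> d x}) = (\<Sum>j\<in>{1..N}. card (?A j))"
    using assms by (intro sum_multicount_gen) auto
  moreover have "{j\<in>{1..N}. j \<le> d x} = {1..d x}" if "x \<in> X" for x
    using assms(2)[OF that] by auto
  ultimately have "(\<Sum>x\<in>X. d x) = (\<Sum>j\<in>{1..N}. card (?A j))" by simp
  then have SA: "S = (\<Sum>j\<in>{1..N}. real (card (?A j)))" unfolding S_def by (simp flip: of_nat_sum)
  have N: "N > 0" using S SA by (cases N) auto
  then have h: "harm N > (0::real)" by (rule harm_pos)
  have "S < (\<Sum>j\<in>{1..N}. S / harm N * inverse (real j))"
  proof (subst SA, rule sum_strict_mono)
    fix j assume j: "j \<in> {1..N}"
    then show "real (card (?A j)) < S / harm N * inverse (real j)"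
      using lt[OF j] h by (simp add: field_simps)
  qed (use N in auto)
  also have "\<dots> = S / harm N * harm N" by (simp add: harm_def sum_distrib_left)
  finally show False using h by simp
qed

section \<open>The codegree inequality for graphs with many copies in dense hosts\<close>

lemma finite_edges: "simple_graph G \<Longrightarrow> finite (edges G)"
  unfolding simple_graph_def by (auto intro: finite_subset[of _ "Pow (verts G)"])

locale dense_copies =
  fixes H :: "'a graph" and f :: "real \<Rightarrow> real" and a :: real and n0 :: "real \<Rightarrow> nat"
  assumes simple: "simple_graph H"
    and f: "\<And>d. d \<in> {0<..1} \<Longrightarrow> f d \<in> {0<..1}"
    and a: "a > 0"
    and copies: "\<And>d (G :: nat graph). d \<in> {0<..1} \<Longrightarrow> simple_graph G \<Longrightarrow> card (verts G) \<ge> n0 d \<Longrightarrow>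
      dense_graph (f d) d G \<Longrightarrow>
      real (card (labelled_copies H G)) \<ge> a * real (card (verts G)) ^ card (verts H) * d ^ card (edges H)"
begin

abbreviation "V \<equiv> verts H"
abbreviation "E \<equiv> edges H"

lemma finite_V: "finite V" and edge_subset: "e \<in> E \<Longrightarrow> e \<subseteq> V" and card_edge: "e \<in> E \<Longrightarrow> card e = 2"
  using simple by (auto simp: simple_graph_def)

lemma finite_E: "finite E"
  using simple by (rule finite_edges)

text \<open>Blowing up \<open>A\<close> makes it large enough for both the copy hypothesis and the
  Chernoff argument and moves it to the natural numbers. Both sides scale by
  \<open>L ^ card V\<close>, so the blow-up factor cancels and the bound holds for small
  \<open>A\<close> too.\<close>

lemma codeg_count_ge_of_min_degree:
  fixes A :: "'b set" and Y :: "'c set"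
  assumes fin: "finite A" "finite Y" and A: "A \<noteq> {}" and Y: "Y \<noteq> {}"
    and \<delta>: "0 < \<delta>" "\<delta> \<le> 1"
    and deg: "\<And>x. x \<in> A \<Longrightarrow> real (card {y\<in>Y. R x y}) \<ge> \<delta> * real (card Y)"
  shows "codeg_count V E R A Y \<ge> a / 2 * real (card A) ^ card V * (\<delta>\<^sup>2 / 8 * real (card Y)) ^ card E"
proof -
  define n where "n = card A"
  have n: "n > 0" using fin A by (simp add: n_def card_gt_0_iff)
  define d where "d = \<delta>\<^sup>2 / 8"
  have "\<delta>\<^sup>2 \<le> 1" using \<delta> by (simp add: power_le_one)
  then have d: "d \<in> {0<..1}" using \<delta> by (auto simp: d_def)
  define \<rho> where "\<rho> = f d"
  have \<rho>: "0 < \<rho>" "\<rho> \<le> 1" using f[OF d] by (auto simp: \<rho>_def)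
  \<comment> \<open>The two summands serve the two size requirements; the final 1 keeps
    \<open>L\<close> positive, so that its power can be cancelled.\<close>
  define L where "L = n0 d + nat \<lceil>32 / (\<delta> * \<rho>)\<^sup>2\<rceil> + 1"
  have "n * L \<ge> L" using n by (cases n) auto
  then have nL: "n * L \<ge> n0 d" "real (n * L) \<ge> 32 / (\<delta> * \<rho>)\<^sup>2"
    unfolding L_def by linarith+
  have L: "L > 0" by (simp add: L_def)
  obtain b where b: "bij_betw b {..<n} A"
    using ex_bij_betw_nat_finite[OF fin(1)] by (auto simp: n_def atLeast0LessThan)
  \<comment> \<open>Reduction modulo \<open>n\<close> gives every element of \<open>A\<close>
    exactly \<open>L\<close> preimages below \<open>n * L\<close>.\<close>
  define h where "h i = b (i mod n)" for i
  let ?X = "{..<n * L}"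
  have h: "h ` ?X \<subseteq> A" using n bij_betwE[OF b] by (auto simp: h_def)
  have fib: "card {i\<in>?X. h i = x} = L" if "x \<in> A" for x
  proof -
    have "x \<in> b ` {..<n}" using that by (simp add: bij_betw_imp_surj_on[OF b])
    then obtain r where r: "r < n" "x = b r" by auto
    have "(b (i mod n) = b r) = (i mod n = r)" for i
      using b r n by (auto simp: bij_betw_def inj_on_eq_iff)
    then show ?thesis using card_mod_fibre[OF r(1), of L] by (simp add: h_def r)
  qed
  have "a / 2 * real (card ?X) ^ card V * (\<delta>\<^sup>2 / 8 * real (card Y)) ^ card E
      \<le> codeg_count V E (\<lambda>i. R (h i)) ?X Y"
  proof (rule codeg_count_ge_if_large[OF simple _ fin(2) Y \<delta>(1) \<rho>(1) _ a])
    show "\<delta> * \<rho> \<le> 1" using \<delta> \<rho> by (simp add: mult_le_one)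
    show "\<delta> * real (card Y) \<le> real (card {y\<in>Y. R (h i) y})" if "i \<in> ?X" for i
      using h that by (intro deg) auto
    show "32 / (\<delta> * \<rho>)\<^sup>2 \<le> real (card ?X)" using nL by simp
    fix G :: "nat graph"
    assume G: "simple_graph G" "card (verts G) = card ?X" "dense_graph \<rho> (\<delta>\<^sup>2 / 8) G"
    then show "a * real (card ?X) ^ card V * (\<delta>\<^sup>2 / 8) ^ card E \<le> real (card (labelled_copies H G))"
      using copies[OF d G(1)] nL by (simp add: \<rho>_def d_def)
  qed simp
  also have "\<dots> = real L ^ card V * codeg_count V E R A Y"
    using finite_V fin edge_subset h fib by (intro codeg_count_blow_up) auto
  finally have "real L ^ card V * (a / 2 * real n ^ card V * (\<delta>\<^sup>2 / 8 * real (card Y)) ^ card E)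
     \<le> real L ^ card V * codeg_count V E R A Y"
    by (simp add: power_mult_distrib mult_ac)
  then show ?thesis using L by (simp add: n_def mult_le_cancel_left_pos)
qed

text \<open>These are the vertices of \<open>H\<close> that are not isolated. Their number, unlike
  that of all vertices, is bounded in terms of the number of edges.\<close>

definition V0 :: "'a set" where "V0 = \<Union>E"

lemma V0_subset: "V0 \<subseteq> V" and edge_subset_V0: "e \<in> E \<Longrightarrow> e \<subseteq> V0"
  using edge_subset by (auto simp: V0_def)

lemma finite_V0: "finite V0"
  using V0_subset finite_V finite_subset by blast

lemma card_V0_le: "card V0 \<le> 2 * card E"
proof -
  have "card V0 \<le> (\<Sum>e\<in>E. card e)" unfolding V0_def by (rule card_Union_le_sum_card)
  also have "\<dots> = 2 * card E" using card_edge by simp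
  finally show ?thesis .
qed

text \<open>
  A single degree threshold \<open>j\<close> captures a \<open>1 / harm (card Y)\<close> proportion of the edges. Since
  \<open>V0\<close> has at most \<open>2 * card E\<close> elements, passing from \<open>X\<close> to the vertices of degree at least
  \<open>j\<close> gains at least as much in density as it loses in vertices.
\<close>
lemma codeg_count_V0_ge_harm:
  fixes X :: "'b set" and Y :: "'c set"
  assumes fin: "finite X" "finite Y" and S: "(\<Sum>x\<in>X. real (card {y\<in>Y. R x y})) > 0"
  shows "a / 2 / 8 ^ card E * (real (card X) ^ card V0 * real (card Y) ^ card E *
      ((\<Sum>x\<in>X. real (card {y\<in>Y. R x y})) / (real (card X) * real (card Y))) ^ (2 * card E))
    \<le> codeg_count V0 E R X Y * harm (card Y) ^ (2 * card E)" (is "?l \<le> _")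
proof -
  define S where "S = (\<Sum>x\<in>X. real (card {y\<in>Y. R x y}))"
  define N where "N = real (card Y)"
  define M where "M = real (card X)"
  let ?v = "card V0" and ?e = "card E" and ?h = "harm (card Y) :: real"
  have "card {y\<in>Y. R x y} \<le> card Y" for x using fin by (intro card_mono) auto
  then obtain j where j: "1 \<le> j" "j \<le> card Y"
      "real j * real (card {x\<in>X. j \<le> card {y\<in>Y. R x y}}) * ?h \<ge> S"
    using exists_degree_threshold[OF fin(1), of "\<lambda>x. card {y\<in>Y. R x y}" "card Y"] S
    by (auto simp: S_def)
  define A where "A = {x\<in>X. j \<le> card {y\<in>Y. R x y}}"
  define \<alpha> where "\<alpha> = real (card A)"
  have S0: "S > 0" using S by (simp add: S_def)
  have AX: "A \<subseteq> X" by (auto simp: A_def)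
  have finA: "finite A" using AX fin finite_subset by blast
  have S_le: "S \<le> real j * \<alpha> * ?h" using j(3) by (simp add: \<alpha>_def A_def)
  with S0 have "\<alpha> \<noteq> 0" by auto
  then have \<alpha>: "\<alpha> > 0" by (simp add: \<alpha>_def)
  then have A0: "A \<noteq> {}" by (auto simp: \<alpha>_def)
  have "\<alpha> \<le> M" unfolding \<alpha>_def M_def using card_mono[OF fin(1) AX] by simp
  then have M: "M > 0" "\<alpha> / M \<le> 1" using \<alpha> by (auto simp: field_simps)
  have N: "N > 0" "Y \<noteq> {}" using j by (auto simp: N_def)
  define \<delta> where "\<delta> = real j / N"
  have \<delta>: "0 < \<delta>" "\<delta> \<le> 1" using j N by (auto simp: \<delta>_def N_def field_simps)
  have h0: "?h \<ge> 0" by (rule harm_nonneg)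
  have "a / 2 * \<alpha> ^ card V * (\<delta>\<^sup>2 / 8 * N) ^ ?e \<le> codeg_count V E R A Y"
    unfolding \<alpha>_def N_def
  proof (rule codeg_count_ge_of_min_degree[OF finA fin(2) A0 N(2) \<delta>])
    fix x assume "x \<in> A"
    then show "\<delta> * real (card Y) \<le> real (card {y\<in>Y. R x y})"
      using N by (auto simp: A_def \<delta>_def N_def)
  qed
  \<comment> \<open>The isolated vertices contribute the same power of \<open>\<alpha>\<close> to
    both sides. It is cancelled before the count is enlarged from \<open>A\<close> to
    \<open>X\<close>.\<close>
  also have "\<dots> = \<alpha> ^ card (V - V0) * codeg_count V0 E R A Y"
    unfolding \<alpha>_def using finite_V finA V0_subset edge_subset_V0 by (rule codeg_count_isolated)
  also have "card V = card (V - V0) + ?v"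
    using card_Diff_subset[OF finite_V0 V0_subset] card_mono[OF finite_V V0_subset] by simp
  finally have "\<alpha> ^ card (V - V0) * (a / 2 * \<alpha> ^ ?v * (\<delta>\<^sup>2 / 8 * N) ^ ?e)
      \<le> \<alpha> ^ card (V - V0) * codeg_count V0 E R A Y"
    by (simp add: power_add mult_ac)
  then have "a / 2 * \<alpha> ^ ?v * (\<delta>\<^sup>2 / 8 * N) ^ ?e \<le> codeg_count V0 E R A Y"
    using \<alpha> by (simp add: mult_le_cancel_left_pos)
  also have "\<dots> \<le> codeg_count V0 E R X Y"
    using finite_V0 fin(1) AX by (rule codeg_count_mono)
  finally have 1: "a / 2 * \<alpha> ^ ?v * (\<delta>\<^sup>2 / 8 * N) ^ ?e \<le> codeg_count V0 E R X Y" .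
  \<comment> \<open>Division of the threshold inequality by \<open>M * N\<close> bounds the edge
    density by \<open>(\<alpha> / M) * (\<delta> * ?h)\<close>.\<close>
  have "M ^ ?v * (S / (M * N)) ^ (2 * ?e) \<le> M ^ ?v * ((\<alpha> / M) * (\<delta> * ?h)) ^ (2 * ?e)"
    using \<alpha> S_le M N S0 by (intro mult_left_mono power_mono) (auto simp: \<delta>_def field_simps)
  also have "\<dots> = M ^ ?v * (\<alpha> / M) ^ (2 * ?e) * (\<delta> * ?h) ^ (2 * ?e)" by (simp only: power_mult_distrib mult_ac)
  \<comment> \<open>Since \<open>\<alpha> / M \<le> 1\<close>, lowering its exponent from
    \<open>2 * card E\<close> to \<open>card V0\<close> only increases the value; what remains
    cancels the power of \<open>M\<close>.\<close>
  also have "\<dots> \<le> M ^ ?v * (\<alpha> / M) ^ ?v * (\<delta> * ?h) ^ (2 * ?e)"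
    using M \<alpha> \<delta> h0 card_V0_le by (intro mult_right_mono mult_left_mono power_decreasing) auto
  also have "M ^ ?v * (\<alpha> / M) ^ ?v = \<alpha> ^ ?v" using M by (simp flip: power_mult_distrib)
  finally have 2: "M ^ ?v * (S / (M * N)) ^ (2 * ?e) \<le> \<alpha> ^ ?v * (\<delta> * ?h) ^ (2 * ?e)" .
  have "?l = a / 2 / 8 ^ ?e * N ^ ?e * (M ^ ?v * (S / (M * N)) ^ (2 * ?e))"
    by (simp add: S_def M_def N_def mult_ac)
  also have "\<dots> \<le> a / 2 / 8 ^ ?e * N ^ ?e * (\<alpha> ^ ?v * (\<delta> * ?h) ^ (2 * ?e))"
    using a N by (intro mult_left_mono[OF 2]) auto
  also have "\<dots> = a / 2 * \<alpha> ^ ?v * (\<delta>\<^sup>2 / 8 * N) ^ ?e * ?h ^ (2 * ?e)"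
    by (simp add: power_mult_distrib power_mult power_divide)
  also have "\<dots> \<le> codeg_count V0 E R X Y * ?h ^ (2 * ?e)"
    using 1 h0 by (intro mult_right_mono) auto
  finally show ?thesis .
qed

text \<open>The lossy bound is applied to the \<open>k\<close>-th tensor power of \<open>R\<close>.
  The main terms become \<open>k\<close>-th powers, the constant stays fixed, and the harmonic
  number of \<open>card Y ^ k\<close> grows only linearly in \<open>k\<close>, so the loss
  disappears in the limit.\<close>

lemma codeg_count_V0_ge:
  fixes X :: "'b set" and Y :: "'c set"
  assumes fin: "finite X" "finite Y" and S: "(\<Sum>x\<in>X. real (card {y\<in>Y. R x y})) > 0"
  shows "real (card X) ^ card V0 * real (card Y) ^ card E *
      ((\<Sum>x\<in>X. real (card {y\<in>Y. R x y})) / (real (card X) * real (card Y))) ^ (2 * card E)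
    \<le> codeg_count V0 E R X Y" (is "?B \<le> ?T")
proof (rule le_of_polynomial_factor[where c = "a / 2 / 8 ^ card E" and L = "ln (real (card Y))" and m = "2 * card E"])
  have "X \<noteq> {}" and "Y \<noteq> {}" using S by auto
  then have Y1: "card Y \<ge> 1" using fin by (simp add: Suc_le_eq card_gt_0_iff)
  then show L0: "0 \<le> ln (real (card Y))" by simp
  show "0 < a / 2 / 8 ^ card E" using a by simp
  show "0 \<le> ?T" by (rule codeg_count_nonneg)
  fix k :: nat
  let ?X = "{..<k} \<rightarrow>\<^sub>E X" and ?Y = "{..<k} \<rightarrow>\<^sub>E Y" and ?R = "\<lambda>x y. \<forall>i<k. R (x i) (y i)"
  have "{y\<in>?Y. ?R x y} = PiE {..<k} (\<lambda>i. {y\<in>Y. R (x i) y})" for x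
    by (auto simp: PiE_iff extensional_def)
  then have deg: "real (card {y\<in>?Y. ?R x y}) = (\<Prod>i<k. real (card {y\<in>Y. R (x i) y}))" for x
    by (simp add: card_PiE)
  have Sk: "(\<Sum>x\<in>?X. real (card {y\<in>?Y. ?R x y})) = (\<Sum>x\<in>X. real (card {y\<in>Y. R x y})) ^ k"
    unfolding deg using fin by (subst prod_sum_PiE[symmetric]) auto
  have cY: "card ?Y = card Y ^ k" and cX: "card ?X = card X ^ k" by (auto simp: card_PiE)
  let ?h = "harm (card ?Y) :: real"
  \<comment> \<open>The sequence \<open>harm n - ln n\<close> decreases from its value 1 at
    \<open>n = 1\<close>.\<close>
  have h: "?h \<le> 1 + real k * ln (real (card Y))"
  proof -
    have "1 \<le> card Y ^ k" using Y1 by simp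
    then have "harm (card Y ^ k) - ln (real (card Y ^ k)) \<le> harm 1 - ln (real 1)"
      using euler_mascheroni_sequence_decreasing[of 1 "card Y ^ k"] by simp
    then show ?thesis using Y1 by (simp add: cY ln_realpow harm_expand)
  qed
  have "a / 2 / 8 ^ card E * ?B ^ k =
    a / 2 / 8 ^ card E * (real (card ?X) ^ card V0 * real (card ?Y) ^ card E *
      ((\<Sum>x\<in>?X. real (card {y\<in>?Y. ?R x y})) / (real (card ?X) * real (card ?Y))) ^ (2 * card E))"
    unfolding Sk cX cY by (simp add: power_mult_distrib power_divide mult.commute flip: power_mult)
  also have "\<dots> \<le> codeg_count V0 E ?R ?X ?Y * ?h ^ (2 * card E)"
    by (rule codeg_count_V0_ge_harm) (use fin S Sk in \<open>auto simp: finite_PiE\<close>)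
  also have "\<dots> \<le> ?T ^ k * (1 + real k * ln (real (card Y))) ^ (2 * card E)"
  proof (rule mult_mono)
    show "codeg_count V0 E ?R ?X ?Y \<le> ?T ^ k"
      using finite_V0 fin edge_subset_V0 by (rule codeg_count_tensor_power)
    show "?h ^ (2 * card E) \<le> (1 + real k * ln (real (card Y))) ^ (2 * card E)"
      using h harm_nonneg by (rule power_mono)
  qed (auto simp: codeg_count_nonneg harm_nonneg)
  finally show "a / 2 / 8 ^ card E * ?B ^ k \<le> ?T ^ k * (1 + real k * ln (real (card Y))) ^ (2 * card E)" .
qed

text \<open>The isolated vertices are put back, and the degenerate cases are settled: without edges
  in \<open>H\<close> both sides equal \<open>card X ^ card V\<close>, and for an empty relation the
  left side vanishes.\<close>

lemma codeg_count_ge: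
  fixes X :: "'b set" and Y :: "'c set"
  assumes fin: "finite X" "finite Y"
  shows "real (card X) ^ card V * real (card Y) ^ card E *
      ((\<Sum>x\<in>X. real (card {y\<in>Y. R x y})) / (real (card X) * real (card Y))) ^ (2 * card E)
    \<le> codeg_count V E R X Y" (is "_ * (?S / _) ^ _ \<le> _")
proof (cases "E = {}")
  case True
  then show ?thesis using finite_V by (simp add: codeg_count_def card_PiE)
next
  case False
  then have e: "card E > 0" using finite_E by (simp add: card_gt_0_iff)
  show ?thesis
  proof (cases "?S > 0")
    case True
    have V: "card V = card (V - V0) + card V0"
      using card_Diff_subset[OF finite_V0 V0_subset] card_mono[OF finite_V V0_subset] by simp
    have iso: "codeg_count V E R X Y = real (card X) ^ card (V - V0) * codeg_count V0 E R X Y"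
      using finite_V fin(1) V0_subset edge_subset_V0 by (rule codeg_count_isolated)
    show ?thesis
      unfolding iso V
      using mult_left_mono[OF codeg_count_V0_ge[OF fin True], of "real (card X) ^ card (V - V0)"]
      by (simp add: power_add mult_ac)
  next
    case False
    moreover have "?S \<ge> 0" by (rule sum_nonneg) simp
    ultimately have "?S = 0" by linarith
    then show ?thesis using e codeg_count_nonneg[of V E R X Y] by (simp add: power_0_left)
  qed
qed

end

section \<open>From codegrees to homomorphisms of the replacement\<close>

text \<open>The power mean inequality, obtained from Bernoulli's inequality after division by the
  mean \<open>m\<close>.\<close>

lemma sum_power_ge:
  fixes g :: "'b \<Rightarrow> real"
  assumes "finite X" "\<And>x. x \<in> X \<Longrightarrow> g x \<ge> 0"
  shows "real (card X) * ((\<Sum>x\<in>X. g x) / real (card X)) ^ t \<le> (\<Sum>x\<in>X. g x ^ t)"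
proof (cases "(\<Sum>x\<in>X. g x) = 0")
  case True
  then have "\<forall>x\<in>X. g x = 0" using assms by (simp add: sum_nonneg_eq_0_iff)
  then show ?thesis using True by (cases t) auto
next
  case False
  define m where "m = (\<Sum>x\<in>X. g x) / real (card X)"
  have X: "real (card X) > 0" using False assms by (auto simp: card_gt_0_iff)
  have "(\<Sum>x\<in>X. g x) > 0" using False assms by (simp add: order_less_le sum_nonneg)
  then have m: "m > 0" using X by (simp add: m_def)
  have "(\<Sum>x\<in>X. g x / m) = real (card X)"
    unfolding sum_divide_distrib[symmetric] using False by (simp add: m_def)
  \<comment> \<open>The quotients \<open>g x / m\<close> have average 1, so the linear term of
    Bernoulli's inequality sums to zero and may be inserted.\<close>
  then have "real (card X) * m ^ t = m ^ t * (real (card X) + real t * ((\<Sum>x\<in>X. g x / m) - real (card X)))"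
    by simp
  also have "\<dots> = (\<Sum>x\<in>X. m ^ t * (1 + real t * (g x / m - 1)))"
    by (simp add: sum.distrib sum_subtractf flip: sum_distrib_left)
  also have "\<dots> \<le> (\<Sum>x\<in>X. m ^ t * (1 + (g x / m - 1)) ^ t)"
    using assms m by (intro sum_mono mult_left_mono Bernoulli_inequality) auto
  also have "\<dots> = (\<Sum>x\<in>X. g x ^ t)" using m by (simp flip: power_mult_distrib)
  finally show ?thesis by (simp add: m_def)
qed

lemma card_verts_K2_replacement:
  assumes "simple_graph H"
  shows "card (verts (K2_replacement t H)) = card (verts H) + t * card (edges H)"
proof -
  have fin: "finite (verts H)" "finite (edges H)"
    using assms finite_edges[of H] by (auto simp: simple_graph_def)
  then have "card (verts (K2_replacement t H)) =
      card (Inl ` verts H :: ('a + 'a set \<times> nat) set) + card (Inr ` (edges H \<times> {..<t}) :: ('a + 'a set \<times> nat) set)"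
    unfolding K2_replacement_def by (simp only: graph.sel) (intro card_Un_disjoint, auto)
  then show ?thesis by (simp add: card_image card_cartesian_product)
qed

lemma card_edges_K2_replacement:
  assumes "simple_graph H"
  shows "card (edges (K2_replacement t H)) = 2 * t * card (edges H)"
proof -
  let ?S = "SIGMA e:edges H. e \<times> {..<t}" and ?g = "\<lambda>(e, x, i). {Inl x, Inr (e, i)}"
  have fin: "finite (edges H)" and e: "\<And>e. e \<in> edges H \<Longrightarrow> card e = 2"
    using assms finite_edges[of H] by (auto simp: simple_graph_def)
  have "edges (K2_replacement t H) = ?g ` ?S"
  proof (intro set_eqI iffI)
    fix p assume "p \<in> edges (K2_replacement t H)"
    then obtain x e i where "p = {Inl x, Inr (e, i)}" "e \<in> edges H" "x \<in> e" "i < t"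
      by (auto simp: K2_replacement_def)
    then show "p \<in> ?g ` ?S" by (intro image_eqI[of _ _ "(e, x, i)"]) auto
  qed (auto simp: K2_replacement_def)
  moreover have "inj_on ?g ?S" by (auto simp: inj_on_def doubleton_eq_iff)
  ultimately have "card (edges (K2_replacement t H)) = card ?S" by (simp add: card_image)
  also have "\<dots> = (\<Sum>e\<in>edges H. card (e \<times> {..<t}))"
    using fin e by (intro card_SigmaI ballI finite_cartesian_product)
      (auto intro: card_ge_0_finite[of e for e :: "'a set"])
  also have "\<dots> = 2 * t * card (edges H)" using e by (simp add: card_cartesian_product)
  finally show ?thesis .
qed

text \<open>Once the original vertices are placed, the \<open>t\<close> new vertices of an edge form
  one \<open>t\<close>-tuple, which must be a common neighbour of the two ends under the
  \<open>t\<close>-fold relation. Choosing such a tuple for each edge gives distinct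
  homomorphisms.\<close>

lemma codeg_count_le_card_homs_K2_replacement:
  fixes H :: "'a graph" and G :: "'b graph"
  assumes H: "simple_graph H" and G: "simple_graph G"
  shows "codeg_count (verts H) (edges H) (\<lambda>x y. \<forall>i<t. {x, y i} \<in> edges G) (verts G) ({..<t} \<rightarrow>\<^sub>E verts G)
    \<le> real (card (homs (K2_replacement t H) G))" (is "codeg_count ?V ?E ?R ?X ?Y \<le> _")
proof -
  define F where "F \<phi> = PiE ?E (\<lambda>e. common_nbrs ?R ?Y (\<phi> ` e))" for \<phi>
  \<comment> \<open>The value \<open>undefined\<close> off \<open>?E\<close> makes the combined map
    extensional; for indices from \<open>t\<close> on, the tuple \<open>\<psi> e\<close> is itself
    \<open>undefined\<close>.\<close>
  define g where "g = (\<lambda>(\<phi> :: 'a \<Rightarrow> 'b, \<psi> :: 'a set \<Rightarrow> nat \<Rightarrow> 'b) z. case z of Inl x \<Rightarrow> \<phi> x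
    | Inr (e, i) \<Rightarrow> if e \<in> ?E then \<psi> e i else undefined)"
  let ?S = "Sigma (?V \<rightarrow>\<^sub>E ?X) F"
  have fin: "finite ?V" "finite ?E" "finite ?X"
    using H G finite_edges[of H] by (auto simp: simple_graph_def)
  have finY: "finite ?Y" using fin by (simp add: finite_PiE)
  have finF: "finite (F \<phi>)" for \<phi>
    unfolding F_def using fin finY by (intro finite_PiE) (auto simp: common_nbrs_def)
  have "codeg_count ?V ?E ?R ?X ?Y = real (\<Sum>\<phi>\<in>?V \<rightarrow>\<^sub>E ?X. card (F \<phi>))"
    using fin by (simp add: codeg_count_def F_def card_PiE)
  also have "(\<Sum>\<phi>\<in>?V \<rightarrow>\<^sub>E ?X. card (F \<phi>)) = card ?S"
    using fin finF by (intro card_SigmaI[symmetric]) (auto simp: finite_PiE)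
  also have "card ?S \<le> card (homs (K2_replacement t H) G)"
  proof (rule card_inj_on_le)
    show "inj_on g ?S"
    proof (rule inj_onI, clarify)
      fix \<phi> \<psi> \<phi>' \<psi>'
      assume in_S: "\<phi> \<in> ?V \<rightarrow>\<^sub>E ?X" "\<psi> \<in> F \<phi>" "\<phi>' \<in> ?V \<rightarrow>\<^sub>E ?X" "\<psi>' \<in> F \<phi>'"
        and eq: "g (\<phi>, \<psi>) = g (\<phi>', \<psi>')"
      have \<phi>: "\<phi> = \<phi>'"
        using fun_cong[OF eq, of "Inl x" for x] by (intro ext) (simp add: g_def)
      have "\<psi> e i = \<psi>' e i" if "e \<in> ?E" for e i
        using fun_cong[OF eq, of "Inr (e, i)"] that by (simp add: g_def)
      then have "\<psi> = \<psi>'"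
        using in_S(2,4) unfolding F_def \<phi> by (rule_tac PiE_ext) auto
      with \<phi> show "\<phi> = \<phi>' \<and> \<psi> = \<psi>'" by blast
    qed
    show "g ` ?S \<subseteq> homs (K2_replacement t H) G"
    proof clarify
      fix \<phi> \<psi> assume \<phi>: "\<phi> \<in> ?V \<rightarrow>\<^sub>E ?X" and \<psi>: "\<psi> \<in> F \<phi>"
      have \<psi>e: "\<psi> e \<in> ?Y \<and> (\<forall>x\<in>e. \<forall>i<t. {\<phi> x, \<psi> e i} \<in> edges G)" if "e \<in> ?E" for e
        using PiE_mem[OF \<psi>[unfolded F_def] that] by (auto simp: common_nbrs_def)
      have "g (\<phi>, \<psi>) \<in> verts (K2_replacement t H) \<rightarrow>\<^sub>E ?X"
      proof (rule PiE_I)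
        fix z assume "z \<in> verts (K2_replacement t H)"
        then show "g (\<phi>, \<psi>) z \<in> ?X"
          using \<phi> \<psi>e by (auto simp: K2_replacement_def g_def PiE_iff)
      next
        fix z assume z: "z \<notin> verts (K2_replacement t H)"
        show "g (\<phi>, \<psi>) z = undefined"
        proof (cases z)
          case (Inl x)
          then show ?thesis using z \<phi> by (auto simp: K2_replacement_def g_def PiE_iff extensional_def)
        next
          case (Inr p)
          obtain e i where p: "p = (e, i)" by (cases p)
          have "\<psi> e i = undefined" if "e \<in> ?E"
            using \<psi>e[OF that] z that Inr p by (intro PiE_arb[of "\<psi> e" "{..<t}"]) (auto simp: K2_replacement_def)
          then show ?thesis using Inr p by (simp add: g_def)
        qed
      qed
      moreover have "g (\<phi>, \<psi>) ` p \<in> edges G" if "p \<in> edges (K2_replacement t H)" for p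
        using that \<psi>e by (auto simp: K2_replacement_def g_def)
      ultimately show "g (\<phi>, \<psi>) \<in> homs (K2_replacement t H) G" by (simp add: homs_def)
    qed
    have "finite (verts (K2_replacement t H))"
      using simple_graph_K2_replacement[OF H] by (simp add: simple_graph_def)
    then have "finite (verts (K2_replacement t H) \<rightarrow>\<^sub>E ?X)" using fin by (simp add: finite_PiE)
    then show "finite (homs (K2_replacement t H) G)" by (rule rev_finite_subset) (auto simp: homs_def)
  qed
  finally show ?thesis by simp
qed

lemma sum_degrees:
  assumes "simple_graph G"
  shows "(\<Sum>x\<in>verts G. card {y\<in>verts G. {x, y} \<in> edges G}) = 2 * card (edges G)"
proof -
  have fin: "finite (verts G)" "finite (edges G)"
    and e: "\<And>e. e \<in> edges G \<Longrightarrow> e \<subseteq> verts G" "\<And>e. e \<in> edges G \<Longrightarrow> card e = 2"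
    using assms finite_edges[of G] by (auto simp: simple_graph_def)
  have "card {y\<in>verts G. {x, y} \<in> edges G} = card {e\<in>edges G. x \<in> e}" for x
  proof (rule bij_betw_same_card)
    show "bij_betw (\<lambda>y. {x, y}) {y\<in>verts G. {x, y} \<in> edges G} {e\<in>edges G. x \<in> e}"
      unfolding bij_betw_def
    proof
      show "inj_on (\<lambda>y. {x, y}) {y\<in>verts G. {x, y} \<in> edges G}"
        by (auto simp: inj_on_def doubleton_eq_iff)
      have "p \<in> (\<lambda>y. {x, y}) ` {y\<in>verts G. {x, y} \<in> edges G}" if p: "p \<in> edges G" "x \<in> p" for p
      proof -
        obtain u v where "p = {u, v}" using e(2)[OF p(1)] by (auto simp: card_2_iff)
        then obtain y where "p = {x, y}" using p(2) by auto
        then show ?thesis using p e(1) by auto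
      qed
      then show "(\<lambda>y. {x, y}) ` {y\<in>verts G. {x, y} \<in> edges G} = {e\<in>edges G. x \<in> e}" by auto
    qed
  qed
  then have "(\<Sum>x\<in>verts G. card {y\<in>verts G. {x, y} \<in> edges G}) = (\<Sum>x\<in>verts G. card {e\<in>edges G. x \<in> e})"
    by simp
  also have "\<dots> = 2 * card (edges G)"
  proof (rule sum_multicount)
    have "{x\<in>verts G. x \<in> p} = p" if "p \<in> edges G" for p using e(1)[OF that] by auto
    then show "\<forall>p\<in>edges G. card {x\<in>verts G. x \<in> p} = 2" using e by simp
  qed (use fin in auto)
  finally show ?thesis .
qed

theorem theorem3p6:
  fixes H :: "'a graph" and t :: nat
    and f :: "real \<Rightarrow> real" and a :: real and n0 :: "real \<Rightarrow> nat"
  assumes "t \<ge> 1"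
    and "simple_graph H"
    and "\<forall>d \<in> {0<..1}. f d \<in> {0<..1}"
    and "a > 0"
    and "\<forall>d \<in> {0<..1}. \<forall>G :: nat graph.
           simple_graph G \<and> card (verts G) \<ge> n0 d \<and> dense_graph (f d) d G \<longrightarrow>
             real (card (labelled_copies H G)) \<ge>
               a * real (card (verts G)) ^ card (verts H) * d ^ card (edges H)"
  shows "sidorenko (K2_replacement t H)"
  unfolding sidorenko_def
proof (intro allI impI)
  fix G :: "nat graph" assume G: "simple_graph G"
  interpret dense_copies H f a n0
    using assms by unfold_locales auto
  let ?X = "verts G" and ?v = "card (verts H)" and ?e = "card (edges H)"
  define d where "d x = real (card {y\<in>?X. {x, y} \<in> edges G})" for x
  define n where "n = real (card ?X)"
  define S where "S = (\<Sum>x\<in>?X. d x)"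
  have finX: "finite ?X" using G by (simp add: simple_graph_def)
  have S: "S = 2 * real (card (edges G))"
    unfolding S_def d_def using sum_degrees[OF G] by (simp flip: of_nat_sum)
  have S0: "S \<ge> 0" using S by simp
  \<comment> \<open>Passing to \<open>t\<close>-tuples turns the replacement into a subdivision; a
    vertex of degree \<open>d x\<close> is related to \<open>d x ^ t\<close> tuples.\<close>
  let ?Y = "{..<t} \<rightarrow>\<^sub>E ?X" and ?R = "\<lambda>x y. \<forall>i<t. {x, y i} \<in> edges G"
  have "{y\<in>?Y. ?R x y} = PiE {..<t} (\<lambda>_. {y\<in>?X. {x, y} \<in> edges G})" for x
    by (auto simp: PiE_iff extensional_def)
  then have deg: "real (card {y\<in>?Y. ?R x y}) = d x ^ t" for x by (simp add: card_PiE d_def)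
  have cY: "real (card ?Y) = n ^ t" by (simp add: card_PiE n_def)
  have "n ^ (?v + t * ?e) * (S / n\<^sup>2) ^ (2 * t * ?e) = n ^ ?v * (n ^ t) ^ ?e * ((S / n\<^sup>2) ^ t) ^ (2 * ?e)"
  proof -
    have "2 * t * ?e = t * (2 * ?e)" by simp
    then show ?thesis by (simp only: power_add power_mult)
  qed
  \<comment> \<open>By the power mean inequality the density of the relation with tuples is at least
    the \<open>t\<close>-th power of the edge density of \<open>G\<close>.\<close>
  also have "\<dots> \<le> n ^ ?v * (n ^ t) ^ ?e * ((\<Sum>x\<in>?X. d x ^ t) / (n * n ^ t)) ^ (2 * ?e)"
  proof (intro mult_left_mono power_mono)
    show "(S / n\<^sup>2) ^ t \<le> (\<Sum>x\<in>?X. d x ^ t) / (n * n ^ t)"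
    proof (cases "n = 0")
      \<comment> \<open>For the empty host both quotients are zero by the convention on division,
        and \<open>t \<ge> 1\<close> makes the power zero as well.\<close>
      case True
      then show ?thesis using assms(1) by (simp add: power_0_left)
    next
      case False
      then have n: "n > 0" by (simp add: n_def)
      have "(S / n\<^sup>2) ^ t = n * (S / n) ^ t / (n * n ^ t)"
        using n by (simp add: power2_eq_square power_divide power_mult_distrib)
      also have "\<dots> \<le> (\<Sum>x\<in>?X. d x ^ t) / (n * n ^ t)"
        using sum_power_ge[OF finX, of d t] n
        by (intro divide_right_mono) (auto simp: S_def n_def d_def)
      finally show ?thesis .
    qed
  qed (use S0 in \<open>auto simp: n_def\<close>)
  also have "\<dots> \<le> codeg_count (verts H) (edges H) ?R ?X ?Y"
    using codeg_count_ge[of ?X ?Y ?R] finX by (simp add: deg cY n_def[symmetric] finite_PiE)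
  also have "\<dots> \<le> real (card (homs (K2_replacement t H) G))"
    using assms(2) G by (rule codeg_count_le_card_homs_K2_replacement)
  finally show "real (card (homs (K2_replacement t H) G)) \<ge>
      real (card ?X) ^ card (verts (K2_replacement t H)) *
      (2 * real (card (edges G)) / real (card ?X) ^ 2) ^ card (edges (K2_replacement t H))"
    unfolding card_verts_K2_replacement[OF assms(2)] card_edges_K2_replacement[OF assms(2)]
    by (simp add: S n_def)
qed

end
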